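(* Let $g\geqslant1$ and let $f(x)=1+\sum_{i=1}^{2g+1}c_ix^i\in\mathbb{C}[x]$ be square-free with $c_{2g+1}\ne0$. The odd, genus $g$ spectral curve $\Gamma_f:\ y^2=f(x)$ associated with a generic orbit of the Volterra map $\mathcal{V}_g$ is isomorphic to $\mathcal{C}$, the even spectral curve $Y^2=\hat{\mathrm{F}}(X)=A(X)^2+4R(X)$ for a corresponding orbit of the J-fraction map $\mathcal{J}_g$, via the birational equivalence $X=x^{-1}+c_1/(2g+2)$, $Y=y/x^{g+1}$. Under this isomorphism of curves, the function $F_0$ on $\Gamma_f$ and the function $Y_1$ on $\mathcal{C}$ are related by $$x^{-1}F_0-w_0=\hat s_0Y_1,$$ and the quantities $d_n,v_n$ satisfying the map $\mathcal{J}_g$ are given in terms of the solution of $\mathcal{V}_g$ by $$d_{j+1}=w_{2j-1}w_{2j},\qquad v_{j+1}=-w_{2j}-w_{2j+1}-\frac{c_1}{2(g+1)},\qquad j\in\mathbb{Z}.$$ Hence each iteration on the orbit of $\mathcal{J}_g$ corresponds to two iterations on the corresponding orbit of $\mathcal{V}_g$.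
   Context: Volterra map. $M_g$ is the space of triplets $\mathcal{P}=1+\sum_{i=1}^gp_ix^i$, $\mathcal{Q}=2+\sum_{i=1}^gq_ix^i$, $\mathcal{R}=\sum_{i=1}^{g+1}r_ix^i$ over $\mathbb{C}$; $\mathcal{V}_g(\mathcal{P},\mathcal{Q},\mathcal{R})=\big(\mathcal{Q}-\mathcal{P},\frac{2\mathcal{P}-\mathcal{Q}+\mathcal{R}}{-wx},-wx\mathcal{Q}\big)$, $w=-\frac12(2p_1-q_1+r_1)$. It preserves $\mathcal{P}^2+\mathcal{Q}\mathcal{R}$; the orbit has spectral curve $\Gamma_f$ if $\mathcal{P}^2+\mathcal{Q}\mathcal{R}=f$. For an orbit $(\mathcal{P}_n,\mathcal{Q}_n,\mathcal{R}_n)_{n\in\mathbb{Z}}$ put $w_n=-\frac12r_{n,1}$ ($r_{n,1}$ the coefficient of $x$ in $\mathcal{R}_n$) and $F_n=\frac{y+\mathcal{P}_n(x)}{\mathcal{Q}_n(x)}$, so that $F_n=1-w_{n+1}x/F_{n+1}$. Generic: all iterates exist and all $w_n\neq0$. J-fraction map. Let $\mathcal{C}:Y^2=\hat{\mathrm{F}}(X)=A(X)^2+4R(X)$ with $A$ monic of degree $g+1$ without $X^g$ term and $R\ne0$ of degree at most $g$; let $\infty_1$ be the point at infinity of its completion where $Y\sim X^{g+1}$. An orbit of $\mathcal{J}_g$ with spectral curve $\mathcal{C}$ is given by functions $Y_n=\frac{Y+P_n(X)}{Q_n(X)}$ on $\mathcal{C}$, $n\in\mathbb{Z}$, with polynomials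 $P_n=A(X)+2d_nX^{g-1}+\mathcal{O}(X^{g-2})$, $Q_n=u_n(X^g-v_nX^{g-1}+\mathcal{O}(X^{g-2}))$, $u_n\neq0$, $P_n^2+Q_nQ_{n-1}=\hat{\mathrm{F}}$, such that $Y_n=\alpha_n+1/Y_{n+1}$ with $\alpha_n=2(X+v_n)/u_n$ the polynomial part of the expansion of $Y_n$ at $\infty_1$; then $u_nu_{n-1}=-4d_n\ne0$. With $\hat s_0=u_1/2$ (an arbitrary non-zero constant) one has $Y_1=\frac1{\hat s_0}\Big(X+v_1-\cfrac{d_2}{X+v_2-\cfrac{d_3}{X+v_3-\cdots}}\Big)$. The prefactors $u_n$ decouple and are disregarded; $\mathcal{J}_g$ is the map $n\to n+1$ on the remaining coefficients of $P_n,Q_n$, or equivalently a system of recurrences for $d_n,v_n$. *)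

theory Defs
  imports Complex_Main "HOL-Computational_Algebra.Computational_Algebra"
begin

subsection \<open>Completed hyperelliptic curves\<close>

text \<open>
  Points of the completion of \<open>y\<^sup>2 = f(x)\<close>. The point \<open>Infinity e\<close> lies over \<open>x = \<infinity>\<close> and
  \<open>e\<close> is the value taken there by the function \<open>y / x^(g+1)\<close>; thus an odd curve has the single
  point \<open>Infinity 0\<close> at infinity, while for \<open>f\<close> monic of degree \<open>2g+2\<close> the point
  \<open>\<infinity>\<^sub>1\<close> (where \<open>y \<sim> x^(g+1)\<close>) is \<open>Infinity 1\<close>.
\<close>

datatype cpoint = Affine complex complex | Infinity complex

definition completed_curve :: "nat \<Rightarrow> complex poly \<Rightarrow> cpoint set" where
  "completed_curve g f =
     {Affine x y |x y. y\<^sup>2 = poly f x} \<union> {Infinity e |e. e\<^sup>2 = coeff f (2 * g + 2)}"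

text \<open>
  The two standard affine charts, each given by its domain and its coordinate map: \<open>(x, y)\<close>, and
  \<open>(1/x, y / x^(g+1))\<close>. Values of the coordinate maps outside the domain are irrelevant.
\<close>

definition aff_dom :: "cpoint set" where
  "aff_dom = {Affine x y |x y. True}"

fun aff_coords :: "cpoint \<Rightarrow> complex \<times> complex" where
  "aff_coords (Affine x y) = (x, y)"
| "aff_coords (Infinity e) = (0, 0)"

definition inf_dom :: "cpoint set" where
  "inf_dom = {Affine x y |x y. x \<noteq> 0} \<union> range Infinity"

fun inf_coords :: "nat \<Rightarrow> cpoint \<Rightarrow> complex \<times> complex" where
  "inf_coords g (Affine x y) = (1 / x, y / x ^ (g + 1))"
| "inf_coords g (Infinity e) = (0, e)"

definition charts :: "nat \<Rightarrow> (cpoint set \<times> (cpoint \<Rightarrow> complex \<times> complex)) set" where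
  "charts g = {(aff_dom, aff_coords), (inf_dom, inf_coords g)}"

text \<open>
  On a chart with coordinates \<open>(s, t)\<close> one has \<open>t\<^sup>2 \<in> \<complex>[s]\<close>, so that every element
  of its coordinate ring has the form \<open>a(s) + b(s) t\<close>.
\<close>

definition chart_fun :: "complex poly \<Rightarrow> complex poly \<Rightarrow> complex \<times> complex \<Rightarrow> complex" where
  "chart_fun a b = (\<lambda>(s, t). poly a s + poly b s * t)"

text \<open>
  Morphisms of algebraic curves: near each point \<open>p\<close>, that is, on a principal open neighbourhood
  \<open>{h \<noteq> 0}\<close> of \<open>p\<close> in some chart of the source, the map lands in a single chart of the target
  and its coordinates there are quotients of elements of the coordinate ring, with denominator \<open>h\<close>.
\<close>

definition curve_morphism :: "nat \<Rightarrow> cpoint set \<Rightarrow> cpoint set \<Rightarrow> (cpoint \<Rightarrow> cpoint) \<Rightarrow> bool" where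
  "curve_morphism g C D \<phi> \<longleftrightarrow>
     \<phi> ` C \<subseteq> D \<and>
     (\<forall>p\<in>C. \<exists>(U, \<chi>)\<in>charts g. \<exists>(W, \<psi>)\<in>charts g. \<exists>a1 b1 a2 b2 h1 h2.
        p \<in> U \<and> chart_fun h1 h2 (\<chi> p) \<noteq> 0 \<and>
        (\<forall>q\<in>C \<inter> U. chart_fun h1 h2 (\<chi> q) \<noteq> 0 \<longrightarrow>
           \<phi> q \<in> W \<and>
           \<psi> (\<phi> q) = (chart_fun a1 b1 (\<chi> q) / chart_fun h1 h2 (\<chi> q),
                      chart_fun a2 b2 (\<chi> q) / chart_fun h1 h2 (\<chi> q))))"

definition curve_iso :: "nat \<Rightarrow> cpoint set \<Rightarrow> cpoint set \<Rightarrow> (cpoint \<Rightarrow> cpoint) \<Rightarrow> bool" where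
  "curve_iso g C D \<phi> \<longleftrightarrow>
     bij_betw \<phi> C D \<and> curve_morphism g C D \<phi> \<and> curve_morphism g D C (inv_into C \<phi>)"

text \<open>
  Rational functions on a curve are represented by their values at points, with arbitrary values at
  the finitely many poles and at the points at infinity. On an irreducible curve two of them are the
  same function iff they agree at all but finitely many points.
\<close>

definition same_fun :: "cpoint set \<Rightarrow> (cpoint \<Rightarrow> complex) \<Rightarrow> (cpoint \<Rightarrow> complex) \<Rightarrow> bool" where
  "same_fun C h k \<longleftrightarrow> finite {p \<in> C. h p \<noteq> k p}"

definition xco :: "cpoint \<Rightarrow> complex" where
  "xco p = fst (aff_coords p)"

definition yco :: "cpoint \<Rightarrow> complex" where
  "yco p = snd (aff_coords p)"

definition quad_fun :: "complex poly \<Rightarrow> complex poly \<Rightarrow> cpoint \<Rightarrow> complex" where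
  "quad_fun P Q p = (yco p + poly P (xco p)) / poly Q (xco p)"

text \<open>
  The filter of punctured neighbourhoods of \<open>\<infinity>\<^sub>1\<close> on \<open>C\<close>; in the chart at infinity
  \<open>\<infinity>\<^sub>1\<close> has coordinates \<open>(0, 1)\<close>.
\<close>

definition at_infty1 :: "nat \<Rightarrow> cpoint set \<Rightarrow> cpoint filter" where
  "at_infty1 g C = inf (filtercomap (inf_coords g) (nhds (0, 1))) (principal (C \<inter> aff_dom))"


subsection \<open>The Volterra map\<close>

definition volterra_space :: "nat \<Rightarrow> (complex poly \<times> complex poly \<times> complex poly) set" where
  "volterra_space g = {(P, Q, R).
     coeff P 0 = 1 \<and> degree P \<le> g \<and>
     coeff Q 0 = 2 \<and> degree Q \<le> g \<and>
     coeff R 0 = 0 \<and> degree R \<le> g + 1}"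

text \<open>
  On \<open>volterra_space g\<close> the numerator \<open>2P - Q + R\<close> has no constant term, so the polynomial
  division by \<open>-wx\<close> is exact when \<open>w \<noteq> 0\<close>.
  For \<open>w = 0\<close> the value is meaningless; generic orbits avoid this case, since the \<open>w\<close> computed from
  the \<open>n\<close>-th triplet equals \<open>volterra_w R (n + 1)\<close>.
\<close>

definition volterra_map ::
  "complex poly \<times> complex poly \<times> complex poly \<Rightarrow> complex poly \<times> complex poly \<times> complex poly" where
  "volterra_map = (\<lambda>(P, Q, R).
     let w = - (2 * coeff P 1 - coeff Q 1 + coeff R 1) / 2
     in (Q - P, (2 * P - Q + R) div monom (- w) 1, monom (- w) 1 * Q))"

definition volterra_w :: "(int \<Rightarrow> complex poly) \<Rightarrow> int \<Rightarrow> complex" where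
  "volterra_w R n = - coeff (R n) 1 / 2"

definition generic_volterra_orbit ::
  "nat \<Rightarrow> (int \<Rightarrow> complex poly) \<Rightarrow> (int \<Rightarrow> complex poly) \<Rightarrow> (int \<Rightarrow> complex poly) \<Rightarrow> bool" where
  "generic_volterra_orbit g P Q R \<longleftrightarrow>
     (\<forall>n. (P n, Q n, R n) \<in> volterra_space g \<and>
          (P (n + 1), Q (n + 1), R (n + 1)) = volterra_map (P n, Q n, R n) \<and>
          volterra_w R n \<noteq> 0)"


subsection \<open>The J-fraction map\<close>

definition jfrac_curve_data :: "nat \<Rightarrow> complex poly \<Rightarrow> complex poly \<Rightarrow> bool" where
  "jfrac_curve_data g A B \<longleftrightarrow>
     degree A = g + 1 \<and> lead_coeff A = 1 \<and> coeff A g = 0 \<and> B \<noteq> 0 \<and> degree B \<le> g"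

definition jfrac_alpha :: "complex \<Rightarrow> complex \<Rightarrow> cpoint \<Rightarrow> complex" where
  "jfrac_alpha u v p = 2 * (xco p + v) / u"

text \<open>
  Orbits with spectral curve \<open>Y\<^sup>2 = A\<^sup>2 + 4B\<close>, for \<open>g \<ge> 1\<close>. A remainder \<open>O(X^(g-2))\<close> in a
  polynomial means that all coefficients of index at least \<open>g - 1\<close> vanish (for \<open>g = 1\<close>: that the
  remainder is zero). The last two conditions say that \<open>Y\<^sub>n = \<alpha>\<^sub>n + 1 / Y\<^sub>n\<^sub>+\<^sub>1\<close> as functions
  on the curve and that \<open>\<alpha>\<^sub>n\<close> is the polynomial part of the expansion of \<open>Y\<^sub>n\<close> at \<open>\<infinity>\<^sub>1\<close>.
\<close>

definition jfrac_orbit ::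
  "nat \<Rightarrow> complex poly \<Rightarrow> complex poly \<Rightarrow> (int \<Rightarrow> complex poly) \<Rightarrow> (int \<Rightarrow> complex poly) \<Rightarrow>
   (int \<Rightarrow> complex) \<Rightarrow> (int \<Rightarrow> complex) \<Rightarrow> (int \<Rightarrow> complex) \<Rightarrow> bool" where
  "jfrac_orbit g A B P Q u d v \<longleftrightarrow>
     (let C = completed_curve g (A\<^sup>2 + 4 * B); Y = (\<lambda>n. quad_fun (P n) (Q n)) in
      \<forall>n. u n \<noteq> 0 \<and>
          (\<forall>i\<ge>g - 1. coeff (P n - (A + monom (2 * d n) (g - 1))) i = 0) \<and>
          (\<forall>i\<ge>g - 1. coeff (Q n - smult (u n) (monom 1 g - monom (v n) (g - 1))) i = 0) \<and>
          (P n)\<^sup>2 + Q n * Q (n - 1) = A\<^sup>2 + 4 * B \<and>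
          same_fun C (Y n) (\<lambda>p. jfrac_alpha (u n) (v n) p + 1 / Y (n + 1) p) \<and>
          ((\<lambda>p. Y n p - jfrac_alpha (u n) (v n) p) \<longlongrightarrow> 0) (at_infty1 g C))"

end

theory Submission imports Defs begin

text \<open>
  The substitution \<open>X = 1/x + shift\<close> exchanges the points \<open>x = 0\<close> and \<open>x = \<infinity>\<close>, so on polynomials it acts by
  reversing coefficients and translating. Contracting two steps of the continued fraction
  \<open>F\<^sub>n = 1 - w\<^sub>n\<^sub>+\<^sub>1 x / F\<^sub>n\<^sub>+\<^sub>1\<close> turns \<open>F\<^sub>2\<^sub>j / x - w\<^sub>2\<^sub>j\<close> into a J-fraction in \<open>X\<close>, which is an explicit
  orbit of the J-fraction map. Every orbit is this one up to prefactors: \<open>1\<close> and \<open>Y\<close> are independent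
  over the rational functions of \<open>X\<close>, so \<open>Y\<^sub>1\<close> determines \<open>P\<^sub>1\<close> and \<open>Q\<^sub>1\<close>, and the recurrence
  determines the rest in both directions.
\<close>

subsection \<open>Reversal of polynomials\<close>

lemma poly_eqI_cofinite:
  fixes p q :: "complex poly"
  assumes "finite S" "\<And>x. x \<notin> S \<Longrightarrow> poly p x = poly q x"
  shows "p = q"
proof (rule ccontr)
  assume "p \<noteq> q"
  then have "finite {x. poly (p - q) x = 0}"
    by (intro poly_roots_finite) simp
  moreover have "- S \<subseteq> {x. poly (p - q) x = 0}"
    using assms(2) by auto
  ultimately have "finite (- S)"
    using finite_subset by blast
  then show False
    using assms(1) infinite_UNIV_char_0 by (metis finite_Un Compl_partition)
qed

lemma poly_altdef_le:
  fixes p :: "'a::comm_semiring_1 poly"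
  assumes "degree p \<le> n"
  shows "poly p x = (\<Sum>i\<le>n. coeff p i * x ^ i)"
  by (subst poly_as_sum_of_monoms'[OF assms, symmetric]) (simp add: poly_sum poly_monom)

lemma coeff_mult_add_le:
  assumes "degree p \<le> m" "degree q \<le> n"
  shows "coeff (p * q) (m + n) = coeff p m * coeff q n"
proof -
  have "coeff (p * q) (m + n) = (\<Sum>i\<le>m+n. coeff p i * coeff q (m + n - i))"
    by (simp add: coeff_mult)
  also have "\<dots> = (\<Sum>i\<in>{m}. coeff p i * coeff q (m + n - i))"
  proof (rule sum.mono_neutral_right)
    show "\<forall>i\<in>{..m+n} - {m}. coeff p i * coeff q (m + n - i) = 0"
    proof
      fix i assume i: "i \<in> {..m+n} - {m}"
      show "coeff p i * coeff q (m + n - i) = 0"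
      proof (cases "i > m")
        case True
        then show ?thesis using assms(1) by (simp add: coeff_eq_0)
      next
        case False
        then have "m + n - i > n" using i by auto
        then show ?thesis using assms(2) by (simp add: coeff_eq_0)
      qed
    qed
  qed auto
  finally show ?thesis by simp
qed

text \<open>The top two coefficients suffice below: they carry \<open>u n\<close> and
  \<open>v n\<close> in \<open>Q n\<close>, and the condition that \<open>X^g\<close> is absent.
  With \<open>n\<close> only an upper bound for the degree, leading cancellation needs no case
  distinction.\<close>

lemma coeff_pcompose_shift:
  fixes a :: "'a::comm_ring_1"
  assumes "degree p \<le> n"
  shows "degree (p \<circ>\<^sub>p [:a, 1:]) \<le> n"
    and "coeff (p \<circ>\<^sub>p [:a, 1:]) n = coeff p n"
    and "n \<ge> 1 \<Longrightarrow> coeff (p \<circ>\<^sub>p [:a, 1:]) (n - 1) = coeff p (n - 1) + of_nat n * a * coeff p n"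
proof -
  have "degree (p \<circ>\<^sub>p [:a, 1:]) \<le> n \<and> coeff (p \<circ>\<^sub>p [:a, 1:]) n = coeff p n \<and>
    (n \<ge> 1 \<longrightarrow> coeff (p \<circ>\<^sub>p [:a, 1:]) (n - 1) = coeff p (n - 1) + of_nat n * a * coeff p n)"
    using assms
  proof (induction n arbitrary: p)
    case 0
    then obtain b where "p = [:b:]" by (metis degree_eq_zeroE le_zero_eq)
    then show ?case by simp
  next
    case (Suc n)
    obtain b q where p: "p = pCons b q" by (cases p)
    have q: "degree q \<le> n" using Suc.prems p by (auto split: if_splits)
    note IH = Suc.IH[OF q]
    let ?r = "q \<circ>\<^sub>p [:a, 1:]"
    \<comment> \<open>Horner step: \<open>p = b + x q\<close> becomes \<open>b + (x + a) r\<close>,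
      where \<open>r\<close> is the translate of \<open>q\<close>.\<close>
    have e: "p \<circ>\<^sub>p [:a, 1:] = [:b:] + smult a ?r + pCons 0 ?r"
      by (simp add: p pcompose_pCons)
    have cn: "coeff ?r (Suc n) = 0"
      using IH by (simp add: coeff_eq_0)
    have "degree (p \<circ>\<^sub>p [:a, 1:]) \<le> Suc n"
      unfolding e using IH
      by (intro degree_add_le) (auto intro: order_trans[OF degree_smult_le] order_trans[OF degree_pCons_le])
    moreover have "coeff (p \<circ>\<^sub>p [:a, 1:]) (Suc n) = coeff p (Suc n)"
      unfolding e using IH cn by (simp add: p)
    moreover have "coeff (p \<circ>\<^sub>p [:a, 1:]) n = coeff p n + of_nat (Suc n) * a * coeff p (Suc n)"
      unfolding e using IH by (cases n) (auto simp: p algebra_simps)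
    ultimately show ?case by simp
  qed
  then show "degree (p \<circ>\<^sub>p [:a, 1:]) \<le> n"
    and "coeff (p \<circ>\<^sub>p [:a, 1:]) n = coeff p n"
    and "n \<ge> 1 \<Longrightarrow> coeff (p \<circ>\<^sub>p [:a, 1:]) (n - 1) = coeff p (n - 1) + of_nat n * a * coeff p n"
    by blast+
qed

section \<open>Coefficient reversal of fixed weight, followed by translation\<close>

definition rev_poly :: "nat \<Rightarrow> complex poly \<Rightarrow> complex poly" where
  "rev_poly N p = (\<Sum>i\<le>N. monom (coeff p i) (N - i))"

lemma coeff_rev_poly: "coeff (rev_poly N p) k = (if k \<le> N then coeff p (N - k) else 0)"
proof -
  have "coeff (rev_poly N p) k = (\<Sum>i\<le>N. if N - i = k then coeff p i else 0)"
    by (simp add: rev_poly_def coeff_sum)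
  also have "\<dots> = (\<Sum>i\<le>N. if i = N - k \<and> k \<le> N then coeff p i else 0)"
    by (intro sum.cong) auto
  also have "\<dots> = (if k \<le> N then coeff p (N - k) else 0)"
    by (cases "k \<le> N") auto
  finally show ?thesis .
qed

lemma degree_rev_poly: "degree (rev_poly N p) \<le> N"
  by (rule degree_le) (simp add: coeff_rev_poly)

lemma poly_rev_poly:
  assumes "degree p \<le> N" "x \<noteq> 0"
  shows "poly (rev_poly N p) x = x ^ N * poly p (1 / x)"
proof -
  have "poly (rev_poly N p) x = (\<Sum>i\<le>N. coeff p i * x ^ (N - i))"
    by (simp add: rev_poly_def poly_sum poly_monom)
  also have "\<dots> = (\<Sum>i\<le>N. x ^ N * (coeff p i * (1 / x) ^ i))"
    using assms(2) by (intro sum.cong) (auto simp: power_diff power_divide)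
  also have "\<dots> = x ^ N * poly p (1 / x)"
    using assms(1) by (simp add: poly_altdef_le sum_distrib_left)
  finally show ?thesis .
qed

text \<open>Under \<open>X = 1/x + a\<close> this is \<open>p(x) / x^N\<close> as a polynomial in
  \<open>X\<close>. The weight \<open>N\<close> is prescribed and not the degree of
  \<open>p\<close>: it is \<open>2g+2\<close> for the curve, \<open>g+1\<close> for numerators and
  \<open>g\<close> for denominators.\<close>

definition flip_poly :: "complex \<Rightarrow> nat \<Rightarrow> complex poly \<Rightarrow> complex poly" where
  "flip_poly a N p = rev_poly N p \<circ>\<^sub>p [:- a, 1:]"

lemma poly_flip:
  assumes "degree p \<le> N" "x \<noteq> a"
  shows "poly (flip_poly a N p) x = (x - a) ^ N * poly p (1 / (x - a))"
  using assms by (simp add: flip_poly_def poly_pcompose poly_rev_poly)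

text \<open>The value \<open>X = a\<close> stands for \<open>x = \<infinity>\<close>, so this
  evaluation describes the points at infinity of the source curve.\<close>

lemma poly_flip_center: "poly (flip_poly a N p) a = coeff p N"
  by (simp add: flip_poly_def poly_pcompose poly_0_coeff_0 coeff_rev_poly)

lemma degree_flip: "degree (flip_poly a N p) \<le> N"
  unfolding flip_poly_def using coeff_pcompose_shift(1)[OF degree_rev_poly] by blast

lemma coeff_flip: "coeff (flip_poly a N p) N = coeff p 0"
  unfolding flip_poly_def by (simp add: coeff_pcompose_shift(2)[OF degree_rev_poly] coeff_rev_poly)

lemma coeff_flip_pred:
  "N \<ge> 1 \<Longrightarrow> coeff (flip_poly a N p) (N - 1) = coeff p 1 - of_nat N * a * coeff p 0"
  unfolding flip_poly_def
  by (subst coeff_pcompose_shift(3)[OF degree_rev_poly]) (auto simp: coeff_rev_poly)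

text \<open>The branch point at \<open>x = \<infinity>\<close> becomes a simple root: after the
  translation is undone, the constant coefficient vanishes and the linear one does not, whereas a
  square vanishes to even order.\<close>

lemma flip_not_square:
  assumes "coeff p (Suc N) = 0" "coeff p N \<noteq> 0"
  shows "flip_poly a (Suc N) p \<noteq> A\<^sup>2"
proof
  assume A: "flip_poly a (Suc N) p = A\<^sup>2"
  define S where "S = A \<circ>\<^sub>p [:a, 1:]"
  have "rev_poly (Suc N) p = flip_poly a (Suc N) p \<circ>\<^sub>p [:a, 1:]"
    unfolding flip_poly_def by (simp add: pcompose_assoc[symmetric] pcompose_pCons pcompose_idR)
  also have "\<dots> = S * S"
    by (simp add: A S_def power2_eq_square pcompose_mult)
  finally have S: "rev_poly (Suc N) p = S * S" .
  have "coeff (S * S) 0 = 0"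
    using assms(1) by (simp add: S[symmetric] coeff_rev_poly)
  then have "coeff S 0 = 0" by (simp add: coeff_mult)
  then have "coeff (S * S) 1 = 0" by (simp add: coeff_mult)
  then show False
    using assms(2) by (simp add: S[symmetric] coeff_rev_poly)
qed

text \<open>The coefficients of the square root are determined from the top downwards.\<close>

lemma monic_sqrt_approx:
  fixes F P :: "complex poly"
  assumes "degree P = g + 1" "lead_coeff P = 1" "degree (F - P\<^sup>2) \<le> 2 * g"
  obtains A where "degree A = g + 1" "lead_coeff A = 1" "coeff A g = coeff P g" "degree (F - A\<^sup>2) \<le> g"
proof -
  have "\<exists>A. degree A = g + 1 \<and> lead_coeff A = 1 \<and> coeff A g = coeff P g \<and> degree (F - A\<^sup>2) \<le> 2 * g - k"
    if "k \<le> g" for k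
    using that
  proof (induction k)
    case 0
    then show ?case using assms by auto
  next
    case (Suc k)
    then obtain A where A: "degree A = g + 1" "lead_coeff A = 1" "coeff A g = coeff P g"
      and dA: "degree (F - A\<^sup>2) \<le> 2 * g - k" by auto
    \<comment> \<open>The cross term \<open>2 * (M * A)\<close> has coefficient \<open>2 * b\<close>
      at index \<open>2 * g - k\<close> and cancels the top of the remainder. \<open>M * M\<close>
      has smaller degree, and the exponent of \<open>M\<close> is below \<open>g\<close>, so the two
      leading coefficients of \<open>A\<close> are kept.\<close>
    define b where "b = coeff (F - A\<^sup>2) (2 * g - k) / 2"
    define M where "M = monom b (g - 1 - k)"
    have dM: "degree M \<le> g - 1 - k" unfolding M_def by (rule degree_monom_le)
    have d: "degree (A + M) = g + 1"
      using A dM Suc.prems by (subst degree_add_eq_left) auto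
    have l: "coeff (A + M) (g + 1) = 1" "coeff (A + M) g = coeff P g"
      using A Suc.prems by (auto simp: M_def)
    have e: "F - (A + M)\<^sup>2 = (F - A\<^sup>2) - 2 * (M * A) - M * M"
      by (simp add: power2_eq_square algebra_simps)
    have i: "2 * g - k = (g - 1 - k) + (g + 1)" using Suc.prems by auto
    have dMA: "degree (M * A) \<le> 2 * g - k"
      using dM A i by (metis add_mono degree_mult_le order.trans order_refl)
    have dMM: "degree (M * M) < 2 * g - k"
      using degree_mult_le[of M M] dM Suc.prems by linarith
    have "coeff (M * A) (2 * g - k) = b"
      unfolding i using coeff_mult_add_le[OF dM, of A "g + 1"] A by (simp add: M_def)
    then have "coeff (2 * (M * A)) (2 * g - k) = coeff (F - A\<^sup>2) (2 * g - k)"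
      unfolding mult_2[of "M * A"] coeff_add by (simp add: b_def mult.commute)
    then have c: "coeff (F - (A + M)\<^sup>2) (2 * g - k) = 0"
      unfolding e using dMM by (simp add: coeff_eq_0)
    have "degree (F - (A + M)\<^sup>2) \<le> 2 * g - k"
      unfolding e mult_2[of "M * A"] using dMM
      by (intro degree_diff_le[OF degree_diff_le[OF dA degree_add_le[OF dMA dMA]]]) simp
    then have "degree (F - (A + M)\<^sup>2) \<le> 2 * g - Suc k"
      using eq_zero_or_degree_less[OF _ c] Suc.prems by force
    then show ?case using d l by metis
  qed
  from this[of g] show ?thesis using that by auto
qed

subsection \<open>Functions on the completed curve\<close>

text \<open>At most two points lie over each root and at most two at infinity. The implication puts
  every point at infinity into the set, so one non-zero polynomial bounds a whole exceptional
  set.\<close>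

lemma finite_roots_curve:
  assumes "q \<noteq> 0"
  shows "finite {p \<in> completed_curve g f. p \<in> aff_dom \<longrightarrow> poly q (xco p) = 0}" (is "finite ?S")
proof -
  have fs: "finite {y::complex. y\<^sup>2 = z}" for z
  proof -
    have "{y::complex. y\<^sup>2 = z} \<subseteq> {csqrt z, - csqrt z}"
      by (auto simp: power2_eq_iff) (metis power2_csqrt power2_eq_iff)
    then show ?thesis by (rule finite_subset) simp
  qed
  have "?S \<subseteq> (\<Union>x\<in>{x. poly q x = 0}. Affine x ` {y. y\<^sup>2 = poly f x}) \<union> Infinity ` {e. e\<^sup>2 = coeff f (2 * g + 2)}"
    by (auto simp: completed_curve_def aff_dom_def xco_def)
  moreover have "finite \<dots>"
    using assms fs by (intro finite_UnI finite_UN_I finite_imageI poly_roots_finite) auto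
  ultimately show ?thesis by (rule finite_subset)
qed

lemma same_funI:
  assumes "q \<noteq> 0"
    and "\<And>x y. y\<^sup>2 = poly f x \<Longrightarrow> poly q x \<noteq> 0 \<Longrightarrow> h (Affine x y) = k (Affine x y)"
  shows "same_fun (completed_curve g f) h k"
  unfolding same_fun_def
  by (rule finite_subset[OF _ finite_roots_curve[OF assms(1), of g f]])
     (use assms(2) in \<open>force simp: completed_curve_def aff_dom_def xco_def\<close>)

text \<open>Projecting the exceptional points to the \<open>x\<close>-line makes the two functions
  agree at both points over each remaining \<open>x\<close>; comparing the two signs of
  \<open>y\<close> depends on this.\<close>

lemma same_funE:
  assumes "same_fun (completed_curve g f) h k"
  obtains S where "finite S"
    "\<And>x y. x \<notin> S \<Longrightarrow> y\<^sup>2 = poly f x \<Longrightarrow> h (Affine x y) = k (Affine x y)"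
proof
  show "finite (xco ` {p \<in> completed_curve g f. h p \<noteq> k p})"
    using assms by (simp add: same_fun_def)
  show "h (Affine x y) = k (Affine x y)"
    if "x \<notin> xco ` {p \<in> completed_curve g f. h p \<noteq> k p}" "y\<^sup>2 = poly f x" for x y
    using that by (force simp: completed_curve_def xco_def image_iff)
qed

lemma same_fun_sym: "same_fun C h k \<Longrightarrow> same_fun C k h"
  by (simp add: same_fun_def eq_commute)

lemma same_fun_trans:
  assumes "same_fun C h k" "same_fun C k l"
  shows "same_fun C h l"
  unfolding same_fun_def
  by (rule finite_subset[OF _ finite_UnI[OF assms[unfolded same_fun_def]]]) auto

lemma same_fun_bij:
  assumes "bij_betw \<phi> C D" "same_fun C (\<lambda>p. h (\<phi> p)) (\<lambda>p. k (\<phi> p))"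
  shows "same_fun D h k"
proof -
  have "{q \<in> D. h q \<noteq> k q} \<subseteq> \<phi> ` {p \<in> C. h (\<phi> p) \<noteq> k (\<phi> p)}"
    using assms(1) by (auto simp: bij_betw_def)
  then show ?thesis
    using assms(2) by (auto simp: same_fun_def intro: finite_subset)
qed

section \<open>Limits at \<open>\<infinity>\<^sub>1\<close>\<close>

lemma same_fun_eventually_at_infty1:
  assumes "same_fun C h k"
  shows "eventually (\<lambda>p. h p = k p) (at_infty1 g C)"
proof -
  let ?E = "{p \<in> C \<inter> aff_dom. h p \<noteq> k p}"
  have fin: "finite ?E"
    using assms unfolding same_fun_def by (rule rev_finite_subset) auto
  \<comment> \<open>For \<open>x = 0\<close> division by zero yields the coordinates
    \<open>(0, 0)\<close>, and for \<open>x \<noteq> 0\<close> the first coordinate is non-zero.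
    Hence finitely many affine points stay away from \<open>(0, 1)\<close>.\<close>
  have ne: "inf_coords g p \<noteq> (0, 1)" if "p \<in> aff_dom" for p
    using that by (cases p) (auto simp: aff_dom_def)
  have "open (- (inf_coords g ` ?E))"
    using fin by (intro open_Compl finite_imp_closed finite_imageI)
  moreover have "(0, 1) \<in> - (inf_coords g ` ?E)"
    using ne by force
  ultimately have "eventually (\<lambda>z. z \<in> - (inf_coords g ` ?E)) (nhds (0, 1))"
    using eventually_nhds by blast
  then have "eventually (\<lambda>p. inf_coords g p \<in> - (inf_coords g ` ?E)) (filtercomap (inf_coords g) (nhds (0, 1)))"
    by (rule eventually_filtercomapI)
  then show ?thesis
    unfolding at_infty1_def eventually_inf_principal by eventually_elim auto
qed

lemma tendsto_at_infty1:
  "((\<lambda>p. 1 / xco p) \<longlongrightarrow> 0) (at_infty1 g C)"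
  "((\<lambda>p. yco p / xco p ^ (g + 1)) \<longlongrightarrow> 1) (at_infty1 g C)"
proof -
  have "filterlim (inf_coords g) (nhds (0, 1)) (at_infty1 g C)"
    unfolding at_infty1_def
    by (rule filterlim_mono[OF filterlim_filtercomap order_refl inf_le1])
  then have t: "((\<lambda>p. fst (inf_coords g p)) \<longlongrightarrow> 0) (at_infty1 g C)"
     "((\<lambda>p. snd (inf_coords g p)) \<longlongrightarrow> 1) (at_infty1 g C)"
    using tendsto_fst tendsto_snd by force+
  have ev: "eventually (\<lambda>p. p \<in> aff_dom) (at_infty1 g C)"
    unfolding at_infty1_def eventually_inf_principal by auto
  show "((\<lambda>p. 1 / xco p) \<longlongrightarrow> 0) (at_infty1 g C)"
    using t(1) by (rule Lim_transform_eventually)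
      (use ev in eventually_elim, auto simp: aff_dom_def xco_def)
  show "((\<lambda>p. yco p / xco p ^ (g + 1)) \<longlongrightarrow> 1) (at_infty1 g C)"
    using t(2) by (rule Lim_transform_eventually)
      (use ev in eventually_elim, auto simp: aff_dom_def xco_def yco_def)
qed

text \<open>At \<open>x = 0\<close> the quotient \<open>y / x^(g+1)\<close> has the default value 0,
  but it tends to 1.\<close>

lemma eventually_xco_nonzero_at_infty1:
  "eventually (\<lambda>p. xco p \<noteq> 0) (at_infty1 g C)"
proof -
  have "eventually (\<lambda>p. yco p / xco p ^ (g + 1) \<noteq> 0) (at_infty1 g C)"
    using tendsto_at_infty1(2) by (rule tendsto_imp_eventually_ne) simp
  then show ?thesis by eventually_elim auto
qed

text \<open>The quotient is a polynomial in \<open>1 / x\<close> whose constant term is the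
  coefficient of index \<open>g + 1\<close>.\<close>

lemma poly_div_power_at_infty1:
  assumes "degree q \<le> g + 1"
  shows "((\<lambda>p. poly q (xco p) / xco p ^ (g + 1)) \<longlongrightarrow> coeff q (g + 1)) (at_infty1 g C)"
proof -
  have "((\<lambda>p. \<Sum>i\<le>g+1. coeff q i * (1 / xco p) ^ (g + 1 - i)) \<longlongrightarrow>
      (\<Sum>i\<le>g+1. coeff q i * 0 ^ (g + 1 - i))) (at_infty1 g C)"
    by (intro tendsto_intros tendsto_at_infty1)
  also have "(\<Sum>i\<le>g+1. coeff q i * 0 ^ (g + 1 - i)) = (\<Sum>i\<in>{g+1}. coeff q i * 0 ^ (g + 1 - i))"
    by (intro sum.mono_neutral_right) (auto simp: power_0_left)
  finally have "((\<lambda>p. \<Sum>i\<le>g+1. coeff q i * (1 / xco p) ^ (g + 1 - i)) \<longlongrightarrow> coeff q (g + 1)) (at_infty1 g C)"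
    by simp
  then show ?thesis
  proof (rule Lim_transform_eventually)
    show "eventually (\<lambda>p. (\<Sum>i\<le>g+1. coeff q i * (1 / xco p) ^ (g + 1 - i)) =
        poly q (xco p) / xco p ^ (g + 1)) (at_infty1 g C)"
      using eventually_xco_nonzero_at_infty1
    proof eventually_elim
      case (elim p)
      show ?case unfolding poly_altdef_le[OF assms] sum_divide_distrib
      proof (intro sum.cong refl)
        fix i assume "i \<in> {..g+1}"
        then have "xco p ^ (g + 1) = xco p ^ i * xco p ^ (g + 1 - i)"
          by (simp flip: power_add)
        then show "coeff q i * (1 / xco p) ^ (g + 1 - i) = coeff q i * xco p ^ i / xco p ^ (g + 1)"
          using elim by (simp add: power_divide)
      qed
    qed
  qed
qed

text \<open>After division by \<open>X^(g+1)\<close> the numerator \<open>Q\<close> tends to 0,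
  while \<open>Y + P\<close> tends to \<open>1 + 1 = 2\<close>: on this branch the two leading terms
  add up instead of cancelling.\<close>

lemma inverse_quad_fun_at_infty1:
  assumes "degree P = g + 1" "lead_coeff P = 1" "degree Q \<le> g"
  shows "((\<lambda>p. 1 / quad_fun P Q p) \<longlongrightarrow> 0) (at_infty1 g C)"
proof -
  have "((\<lambda>p. (poly Q (xco p) / xco p ^ (g + 1)) /
     (yco p / xco p ^ (g + 1) + poly P (xco p) / xco p ^ (g + 1))) \<longlongrightarrow> coeff Q (g + 1) / (1 + coeff P (g + 1)))
     (at_infty1 g C)"
    using assms by (intro tendsto_intros tendsto_at_infty1 poly_div_power_at_infty1) auto
  moreover have "coeff Q (g + 1) = 0" using assms by (intro coeff_eq_0) auto
  ultimately have "((\<lambda>p. (poly Q (xco p) / xco p ^ (g + 1)) /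
     (yco p / xco p ^ (g + 1) + poly P (xco p) / xco p ^ (g + 1))) \<longlongrightarrow> 0) (at_infty1 g C)"
    by simp
  then show ?thesis
    by (rule Lim_transform_eventually)
      (use eventually_xco_nonzero_at_infty1 in eventually_elim,
        auto simp: quad_fun_def divide_simps simp flip: add_divide_distrib)
qed

text \<open>Over almost every \<open>x\<close> there are two points with opposite non-zero
  \<open>y\<close>. Subtracting the two cross-multiplied equations gives equality of the
  denominators, and then the numerators agree.\<close>

lemma quad_fun_unique:
  assumes "f \<noteq> 0" "Q \<noteq> 0" "Q' \<noteq> 0"
    and "same_fun (completed_curve g f) (quad_fun P Q) (quad_fun P' Q')"
  shows "P = P'" "Q = Q'"
proof -
  obtain S where S: "finite S" "\<And>x y. x \<notin> S \<Longrightarrow> y\<^sup>2 = poly f x \<Longrightarrow>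
      quad_fun P Q (Affine x y) = quad_fun P' Q' (Affine x y)"
    using same_funE[OF assms(4)] by blast
  define T where "T = S \<union> {x. poly (f * Q * Q') x = 0}"
  have T: "finite T"
    unfolding T_def using S(1) assms by (intro finite_UnI poly_roots_finite) auto
  have *: "poly Q x = poly Q' x \<and> poly P x = poly P' x" if "x \<notin> T" for x
  proof -
    define y where "y = csqrt (poly f x)"
    have nz: "x \<notin> S" "poly f x \<noteq> 0" "poly Q x \<noteq> 0" "poly Q' x \<noteq> 0"
      using that by (auto simp: T_def)
    have y: "y\<^sup>2 = poly f x" "(- y)\<^sup>2 = poly f x" "y \<noteq> 0" using nz by (auto simp: y_def)
    have e: "(y + poly P x) * poly Q' x = (y + poly P' x) * poly Q x"
        "(- y + poly P x) * poly Q' x = (- y + poly P' x) * poly Q x"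
      using S(2)[OF nz(1) y(1)] S(2)[OF nz(1) y(2)] nz
      by (auto simp: quad_fun_def xco_def yco_def frac_eq_eq)
    have "2 * y * poly Q' x = 2 * y * poly Q x" using e by algebra
    then have q: "poly Q' x = poly Q x" using y by simp
    then show ?thesis using e nz by auto
  qed
  show "P = P'" "Q = Q'"
    using * by (auto intro: poly_eqI_cofinite[OF T])
qed

subsection \<open>The isomorphism of curves\<close>

definition regular_at :: "nat \<Rightarrow> cpoint set \<Rightarrow> (cpoint \<Rightarrow> cpoint) \<Rightarrow> cpoint \<Rightarrow> bool" where
  "regular_at g C \<phi> p \<longleftrightarrow>
     (\<exists>(U, \<chi>)\<in>charts g. \<exists>(W, \<psi>)\<in>charts g. \<exists>a1 b1 a2 b2 h1 h2.
        p \<in> U \<and> chart_fun h1 h2 (\<chi> p) \<noteq> 0 \<and>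
        (\<forall>q\<in>C \<inter> U. chart_fun h1 h2 (\<chi> q) \<noteq> 0 \<longrightarrow>
           \<phi> q \<in> W \<and>
           \<psi> (\<phi> q) = (chart_fun a1 b1 (\<chi> q) / chart_fun h1 h2 (\<chi> q),
                      chart_fun a2 b2 (\<chi> q) / chart_fun h1 h2 (\<chi> q))))"

lemma curve_morphism_iff:
  "curve_morphism g C D \<phi> \<longleftrightarrow> \<phi> ` C \<subseteq> D \<and> (\<forall>p\<in>C. regular_at g C \<phi> p)"
  by (simp only: curve_morphism_def regular_at_def)

text \<open>The coordinate formulas are demanded on the whole chart and not only on
  \<open>C\<close>; those used below hold without the equation of the curve.\<close>

lemma regular_atI:
  assumes c: "(U, \<chi>) \<in> charts g" "(W, \<psi>) \<in> charts g"
    and p: "p \<in> U" "chart_fun h1 h2 (\<chi> p) \<noteq> 0"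
    and q: "\<And>q. q \<in> U \<Longrightarrow> chart_fun h1 h2 (\<chi> q) \<noteq> 0 \<Longrightarrow> \<phi> q \<in> W \<and>
           \<psi> (\<phi> q) = (chart_fun a1 b1 (\<chi> q) / chart_fun h1 h2 (\<chi> q),
                      chart_fun a2 b2 (\<chi> q) / chart_fun h1 h2 (\<chi> q))"
  shows "regular_at g C \<phi> p"
  unfolding regular_at_def
  by (rule bexI[OF _ c(1)], unfold split, rule bexI[OF _ c(2)], unfold split,
      intro exI conjI ballI impI, (rule p)+, (rule q[THEN conjunct1]; blast),
      (rule q[THEN conjunct2]; blast))

lemma chart_fun_linear_power:
  "chart_fun ([:b, c:] ^ n) 0 (s, t) = (b + s * c) ^ n"
  "chart_fun ([:0, 1:] * [:b, c:] ^ n) 0 (s, t) = s * (b + s * c) ^ n"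
  by (simp_all add: chart_fun_def poly_mult del: mult_pCons_left)

lemma curve_morphism_cong:
  assumes "\<And>p. p \<in> C \<Longrightarrow> \<phi> p = \<phi>' p"
  shows "curve_morphism g C D \<phi> \<longleftrightarrow> curve_morphism g C D \<phi>'"
  unfolding curve_morphism_iff regular_at_def using assms by (simp cong: image_cong)

text \<open>The values at the special points are limits:
  \<open>Y / X^(g+1) = y / (1 + a x)^(g+1)\<close> takes the value \<open>y\<close> at
  \<open>x = 0\<close>, and at \<open>Infinity e\<close> the function \<open>y / x^(g+1)\<close>
  equals \<open>e\<close> while \<open>1 / x\<close> vanishes.\<close>

fun curve_flip :: "complex \<Rightarrow> nat \<Rightarrow> cpoint \<Rightarrow> cpoint" where
  "curve_flip a g (Affine x y) =
     (if x = 0 then Infinity y else Affine (1 / x + a) (y / x ^ (g + 1)))"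
| "curve_flip a g (Infinity e) = Affine a e"

fun curve_unflip :: "complex \<Rightarrow> nat \<Rightarrow> cpoint \<Rightarrow> cpoint" where
  "curve_unflip a g (Affine x y) =
     (if x = a then Infinity y else Affine (1 / (x - a)) (y / (x - a) ^ (g + 1)))"
| "curve_unflip a g (Infinity e) = Affine 0 e"

lemma curve_unflip_flip [simp]: "curve_unflip a g (curve_flip a g p) = p"
  by (cases p) (auto simp: power_divide)

lemma curve_flip_unflip [simp]: "curve_flip a g (curve_unflip a g p) = p"
  by (cases p) (auto simp: power_divide)

lemma square_div_power:
  fixes x y :: "'a::field"
  shows "(y / x ^ (g + 1))\<^sup>2 = y\<^sup>2 / x ^ (2 * g + 2)"
proof -
  have "2 * g + 2 = (g + 1) * 2" by simp
  then show ?thesis by (metis power_divide power_mult)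
qed

lemma curve_flip_in:
  assumes "degree f \<le> 2 * g + 2" "p \<in> completed_curve g f"
  shows "curve_flip a g p \<in> completed_curve g (flip_poly a (2 * g + 2) f)"
proof -
  have "(y / x ^ (g + 1))\<^sup>2 = poly (flip_poly a (2 * g + 2) f) (1 / x + a)"
    if "x \<noteq> 0" "y\<^sup>2 = poly f x" for x y
    using that poly_flip[OF assms(1), of "1 / x + a" a]
    by (simp only: square_div_power) (simp add: power_divide)
  then show ?thesis
    using assms(2)
    by (auto simp: completed_curve_def poly_flip_center coeff_flip poly_0_coeff_0)
qed

lemma curve_unflip_in:
  assumes "degree f \<le> 2 * g + 2" "p \<in> completed_curve g (flip_poly a (2 * g + 2) f)"
  shows "curve_unflip a g p \<in> completed_curve g f"
proof -
  have "(y / (x - a) ^ (g + 1))\<^sup>2 = poly f (1 / (x - a))"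
    if "x \<noteq> a" "y\<^sup>2 = poly (flip_poly a (2 * g + 2) f) x" for x y
    using that poly_flip[OF assms(1), of x a]
    by (simp only: square_div_power) simp
  then show ?thesis
    using assms(2)
    by (auto simp: completed_curve_def poly_flip_center coeff_flip poly_0_coeff_0 split: if_splits)
qed

section \<open>Regularity of the map and of its inverse\<close>

lemma curve_flip_morphism:
  assumes "curve_flip a g ` C \<subseteq> D"
  shows "curve_morphism g C D (curve_flip a g)"
  unfolding curve_morphism_iff
proof (intro conjI ballI assms)
  fix p assume "p \<in> C"
  show "regular_at g C (curve_flip a g) p"
  proof (cases "p \<in> inf_dom")
    case True
    \<comment> \<open>From the chart at infinity to the affine chart the map is the translation
      \<open>(s, t)\<close> to \<open>(s + a, t)\<close>, so the denominator is 1.\<close>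
    show ?thesis
    proof (rule regular_atI[where \<chi> = "inf_coords g" and \<psi> = aff_coords and
          ?a1.0 = "[:a, 1:]" and ?b1.0 = 0 and ?a2.0 = 0 and ?b2.0 = 1 and ?h1.0 = 1 and ?h2.0 = 0])
      fix q assume "q \<in> inf_dom"
      then show "curve_flip a g q \<in> aff_dom \<and> aff_coords (curve_flip a g q) =
        (chart_fun [:a, 1:] 0 (inf_coords g q) / chart_fun 1 0 (inf_coords g q),
         chart_fun 0 1 (inf_coords g q) / chart_fun 1 0 (inf_coords g q))"
        by (auto simp: inf_dom_def aff_dom_def chart_fun_def)
    qed (use True in \<open>auto simp: charts_def chart_fun_def split: prod.split\<close>)
  next
    case False
    then obtain y where p: "p = Affine 0 y"
      by (cases p) (auto simp: inf_dom_def)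
    \<comment> \<open>Near \<open>x = 0\<close> the target coordinates are
      \<open>1/X = x / (1 + a x)\<close> and \<open>Y / X^(g+1) = y / (1 + a x)^(g+1)\<close>. The
      first fraction is expanded by \<open>?l ^ g\<close> to share the denominator of the
      second.\<close>
    let ?l = "[:1, a:]"
    show ?thesis
    proof (rule regular_atI[where \<chi> = aff_coords and \<psi> = "inf_coords g" and
          ?a1.0 = "[:0, 1:] * ?l ^ g" and ?b1.0 = 0 and ?a2.0 = 0 and ?b2.0 = 1 and
          ?h1.0 = "?l ^ (g + 1)" and ?h2.0 = 0])
      fix q assume *: "q \<in> aff_dom" "chart_fun (?l ^ (g + 1)) 0 (aff_coords q) \<noteq> 0"
      obtain x y where q: "q = Affine x y" using *(1) by (auto simp: aff_dom_def)
      have l: "1 + x * a \<noteq> 0" using *(2) by (simp only: q aff_coords.simps chart_fun_linear_power) auto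
      show "curve_flip a g q \<in> inf_dom \<and> inf_coords g (curve_flip a g q) =
        (chart_fun ([:0, 1:] * ?l ^ g) 0 (aff_coords q) / chart_fun (?l ^ (g + 1)) 0 (aff_coords q),
         chart_fun 0 1 (aff_coords q) / chart_fun (?l ^ (g + 1)) 0 (aff_coords q))"
      proof (cases "x = 0")
        case True
        then show ?thesis
          unfolding q aff_coords.simps chart_fun_linear_power by (simp add: inf_dom_def chart_fun_def)
      next
        case False
        then have e: "1 / x + a = (1 + x * a) / x" by (simp add: field_simps)
        show ?thesis
          using False l unfolding q aff_coords.simps chart_fun_linear_power
          by (simp add: inf_dom_def chart_fun_def e power_divide)
      qed
    qed (auto simp: p charts_def chart_fun_def aff_dom_def)
  qed
qed

lemma curve_unflip_morphism:
  assumes "curve_unflip a g ` C \<subseteq> D"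
  shows "curve_morphism g C D (curve_unflip a g)"
  unfolding curve_morphism_iff
proof (intro conjI ballI assms)
  fix p assume "p \<in> C"
  show "regular_at g C (curve_unflip a g) p"
  proof (cases p)
    case (Affine x y)
    \<comment> \<open>The chart at infinity of the target has coordinates \<open>1/x = X - a\<close>
      and \<open>y / x^(g+1) = Y\<close>, which are polynomial.\<close>
    show ?thesis
    proof (rule regular_atI[where \<chi> = aff_coords and \<psi> = "inf_coords g" and
          ?a1.0 = "[:- a, 1:]" and ?b1.0 = 0 and ?a2.0 = 0 and ?b2.0 = 1 and ?h1.0 = 1 and ?h2.0 = 0])
      fix q assume "q \<in> aff_dom"
      then show "curve_unflip a g q \<in> inf_dom \<and> inf_coords g (curve_unflip a g q) =
        (chart_fun [:- a, 1:] 0 (aff_coords q) / chart_fun 1 0 (aff_coords q),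
         chart_fun 0 1 (aff_coords q) / chart_fun 1 0 (aff_coords q))"
        by (auto simp: inf_dom_def aff_dom_def chart_fun_def power_divide)
    qed (auto simp: Affine charts_def chart_fun_def aff_dom_def)
  next
    case (Infinity e)
    \<comment> \<open>With \<open>S = 1/X\<close> and \<open>T = Y / X^(g+1)\<close> one has
      \<open>x = S / (1 - a S)\<close> and \<open>y = T / (1 - a S)^(g+1)\<close>.\<close>
    let ?l = "[:1, - a:]"
    show ?thesis
    proof (rule regular_atI[where \<chi> = "inf_coords g" and \<psi> = aff_coords and
          ?a1.0 = "[:0, 1:] * ?l ^ g" and ?b1.0 = 0 and ?a2.0 = 0 and ?b2.0 = 1 and
          ?h1.0 = "?l ^ (g + 1)" and ?h2.0 = 0])
      fix q assume *: "q \<in> inf_dom" "chart_fun (?l ^ (g + 1)) 0 (inf_coords g q) \<noteq> 0"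
      show "curve_unflip a g q \<in> aff_dom \<and> aff_coords (curve_unflip a g q) =
        (chart_fun ([:0, 1:] * ?l ^ g) 0 (inf_coords g q) / chart_fun (?l ^ (g + 1)) 0 (inf_coords g q),
         chart_fun 0 1 (inf_coords g q) / chart_fun (?l ^ (g + 1)) 0 (inf_coords g q))"
      proof (cases q)
        case (Affine x y)
        have x: "x \<noteq> 0" using *(1) by (auto simp: Affine inf_dom_def)
        have e: "1 + 1 / x * - a = (x - a) / x" using x by (simp add: field_simps)
        have "(1 + 1 / x * - a) ^ (g + 1) \<noteq> 0"
          using *(2) by (simp only: Affine inf_coords.simps chart_fun_linear_power not_False_eq_True)
        then have xa: "x - a \<noteq> 0" unfolding e by auto
        show ?thesis
          using x xa unfolding Affine inf_coords.simps chart_fun_linear_power e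
          by (simp add: aff_dom_def chart_fun_def power_divide)
      next
        case (Infinity e)
        then show ?thesis
          unfolding Infinity inf_coords.simps chart_fun_linear_power by (simp add: aff_dom_def chart_fun_def)
      qed
    qed (auto simp: Infinity charts_def chart_fun_def inf_dom_def)
  qed
qed

lemma curve_flip_iso:
  assumes "degree f \<le> 2 * g + 2"
  shows "curve_iso g (completed_curve g f) (completed_curve g (flip_poly a (2 * g + 2) f)) (curve_flip a g)"
    (is "curve_iso g ?C ?D ?\<phi>")
proof -
  have bij: "bij_betw ?\<phi> ?C ?D"
    using curve_flip_in[OF assms] curve_unflip_in[OF assms]
    by (intro bij_betwI[where g = "curve_unflip a g"]) auto
  \<comment> \<open>\<open>inv_into\<close> is controlled only on the target curve, so regularity is
    transferred by \<open>curve_morphism_cong\<close>.\<close>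
  have inv: "inv_into ?C ?\<phi> q = curve_unflip a g q" if "q \<in> ?D" for q
    using that curve_unflip_in[OF assms] by (intro inv_into_f_eq[OF bij_betw_imp_inj_on[OF bij]]) auto
  have "curve_morphism g ?D ?C (curve_unflip a g)"
    using curve_unflip_in[OF assms] by (intro curve_unflip_morphism) auto
  then have "curve_morphism g ?D ?C (inv_into ?C ?\<phi>)"
    using curve_morphism_cong[of ?D "inv_into ?C ?\<phi>" "curve_unflip a g"] inv by blast
  moreover have "curve_morphism g ?C ?D ?\<phi>"
    using curve_flip_in[OF assms] by (intro curve_flip_morphism) auto
  ultimately show ?thesis
    unfolding curve_iso_def using bij by blast
qed

subsection \<open>Orbits of the J-fraction map\<close>

text \<open>Multiplying \<open>Y\<^sub>n = \<alpha>\<^sub>n + 1 / Y\<^sub>n\<^sub>+\<^sub>1\<close> by \<open>Q\<^sub>n\<close> cancels \<open>Y\<close> and leaves the linear identity \<open>rec\<close>.\<close>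

lemma jfrac_orbitD:
  assumes "jfrac_orbit g A B P Q u d v" "g \<ge> 1"
  shows u: "u n \<noteq> 0"
    and dP: "2 * d n = coeff (P n) (g - 1) - coeff A (g - 1)"
    and uQ: "u n = coeff (Q n) g"
    and vQ: "v n = - coeff (Q n) (g - 1) / coeff (Q n) g"
    and norm: "(P n)\<^sup>2 + Q n * Q (n - 1) = A\<^sup>2 + 4 * B"
    and rec: "P n + P (n + 1) = smult (2 / u n) ([:v n, 1:] * Q n)"
proof -
  note D = assms(1)[unfolded jfrac_orbit_def Let_def, rule_format, of n]
  show u: "u n \<noteq> 0" using D by blast
  show "2 * d n = coeff (P n) (g - 1) - coeff A (g - 1)"
    using D[THEN conjunct2, THEN conjunct1, rule_format, of "g - 1"] by simp
  have Q: "coeff (Q n) i = u n * (coeff (monom 1 g) i - coeff (monom (v n) (g - 1)) i)" if "i \<ge> g - 1" for i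
    using D[THEN conjunct2, THEN conjunct2, THEN conjunct1, rule_format, OF that] by simp
  show uQ: "u n = coeff (Q n) g" using Q[of g] assms(2) by simp
  show "v n = - coeff (Q n) (g - 1) / coeff (Q n) g"
  proof -
    have "g \<noteq> g - 1" using assms(2) by simp
    then have "coeff (Q n) (g - 1) = - u n * v n" using Q[of "g - 1"] by simp
    then show ?thesis using u uQ by simp
  qed
  show norm: "(P n)\<^sup>2 + Q n * Q (n - 1) = A\<^sup>2 + 4 * B" using D by blast
  let ?f = "A\<^sup>2 + 4 * B"
  have norm': "(P (n + 1))\<^sup>2 + Q (n + 1) * Q n = ?f"
    and u': "u (n + 1) \<noteq> 0"
    and Q': "coeff (Q (n + 1) - smult (u (n + 1)) (monom 1 g - monom (v (n + 1)) (g - 1))) g = 0"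
    using assms(1)[unfolded jfrac_orbit_def Let_def, rule_format, of "n + 1"] by auto
  have "g \<noteq> g - 1" using assms(2) by simp
  then have nz: "Q n \<noteq> 0" "Q (n + 1) \<noteq> 0"
    using uQ u Q' u' by auto
  have "same_fun (completed_curve g ?f) (quad_fun (P n) (Q n))
      (\<lambda>p. jfrac_alpha (u n) (v n) p + 1 / quad_fun (P (n + 1)) (Q (n + 1)) p)"
    by (rule D[THEN conjunct2, THEN conjunct2, THEN conjunct2, THEN conjunct2, THEN conjunct1])
  from same_funE[OF this] obtain S where S: "finite S" "\<And>x y. x \<notin> S \<Longrightarrow> y\<^sup>2 = poly ?f x \<Longrightarrow>
      quad_fun (P n) (Q n) (Affine x y) =
      jfrac_alpha (u n) (v n) (Affine x y) + 1 / quad_fun (P (n + 1)) (Q (n + 1)) (Affine x y)"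
    by blast
  define T where "T = S \<union> {x. poly (Q n * Q (n + 1)) x = 0}"
  have T: "finite T"
    unfolding T_def using S(1) nz by (intro finite_UnI poly_roots_finite) auto
  show "P n + P (n + 1) = smult (2 / u n) ([:v n, 1:] * Q n)"
  proof (rule poly_eqI_cofinite[OF T])
    fix x assume "x \<notin> T"
    then have x: "x \<notin> S" "poly (Q n) x \<noteq> 0" "poly (Q (n + 1)) x \<noteq> 0" by (auto simp: T_def)
    define y where "y = csqrt (poly ?f x)"
    have y: "y\<^sup>2 = poly ?f x" by (simp add: y_def)
    let ?P = "poly (P n) x" and ?P' = "poly (P (n + 1)) x"
    let ?Q = "poly (Q n) x" and ?Q' = "poly (Q (n + 1)) x"
    \<comment> \<open>The norm identity at \<open>n + 1\<close> rationalises
      \<open>1 / Y_(n+1)\<close> to \<open>(y - P_(n+1)) / Q_n\<close>, after which \<open>y\<close>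
      drops out of the recurrence.\<close>
    have n': "(y + ?P') * (y - ?P') = ?Q * ?Q'"
      using arg_cong[OF norm', of "\<lambda>p. poly p x"] y
      by (simp add: power2_eq_square algebra_simps)
    then have nz': "y + ?P' \<noteq> 0" using x by auto
    have "(y + ?P) / ?Q = 2 * (x + v n) / u n + ?Q' / (y + ?P')"
      using S(2)[OF x(1) y] by (simp add: quad_fun_def jfrac_alpha_def xco_def yco_def)
    also have "?Q' / (y + ?P') = (y - ?P') / ?Q"
      using n' nz' x by (simp add: frac_eq_eq mult.commute)
    finally have "(?P + ?P') / ?Q = 2 * (x + v n) / u n"
      by (simp add: add_divide_distrib diff_divide_distrib)
    then have "?P + ?P' = 2 * (x + v n) / u n * ?Q"
      using x by (simp add: divide_eq_eq)
    then show "poly (P n + P (n + 1)) x = poly (smult (2 / u n) ([:v n, 1:] * Q n)) x"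
      by (simp add: add.commute) (simp add: distrib_left distrib_right)
  qed
qed

text \<open>\<open>Q n\<close> determines \<open>u n\<close> and \<open>v n\<close>. Going up,
  \<open>rec\<close> yields the next \<open>P\<close> and then the norm identity the next
  \<open>Q\<close>; going down, the norm identity first yields the previous \<open>Q\<close> and
  then \<open>rec\<close> the previous \<open>P\<close>.\<close>

lemma jfrac_orbit_unique:
  assumes "jfrac_orbit g A B P Q u d v" "jfrac_orbit g A B P' Q' u' d' v'" "g \<ge> 1"
    and "P m = P' m" "Q m = Q' m"
  shows "P n = P' n" "Q n = Q' n" "u n = u' n" "d n = d' n" "v n = v' n"
proof -
  note D = jfrac_orbitD[OF assms(1,3)] and D' = jfrac_orbitD[OF assms(2,3)]
  have nz: "Q n \<noteq> 0" for n using D(1,3)[of n] by auto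
  have uv: "u n = u' n \<and> v n = v' n" if "Q n = Q' n" for n
    using that D(3,4)[of n] D'(3,4)[of n] by simp
  have PQ: "P n = P' n \<and> Q n = Q' n"
  proof (induction n rule: int_induct[where k = m])
    case base
    then show ?case using assms by simp
  next
    case (step1 i)
    then have i: "P i = P' i" "Q i = Q' i" by auto
    have "P i + P (i + 1) = P i + P' (i + 1)"
      using D(6)[of i] D'(6)[of i] i uv[OF i(2)] by simp
    then have P: "P (i + 1) = P' (i + 1)" by simp
    have "(P (i + 1))\<^sup>2 + Q (i + 1) * Q i = (P (i + 1))\<^sup>2 + Q' (i + 1) * Q i"
      using D(5)[of "i + 1"] D'(5)[of "i + 1"] by (simp add: P i(2))
    then show ?case using P nz[of i] by simp
  next
    case (step2 i)
    then have i: "P i = P' i" "Q i = Q' i" by auto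
    have "(P i)\<^sup>2 + Q i * Q (i - 1) = (P i)\<^sup>2 + Q i * Q' (i - 1)"
      using D(5)[of i] D'(5)[of i] by (simp add: i)
    then have Q: "Q (i - 1) = Q' (i - 1)" using nz[of i] by simp
    have "P (i - 1) + P i = P' (i - 1) + P i"
      using D(6)[of "i - 1"] D'(6)[of "i - 1"] uv[OF Q] by (simp add: i Q)
    then show ?case using Q by simp
  qed
  then show "P n = P' n" "Q n = Q' n" by simp_all
  then show "u n = u' n" "v n = v' n" using uv by simp_all
  show "d n = d' n" using D(2)[of n] D'(2)[of n] PQ by (metis mult_cancel_left zero_neq_numeral)
qed

text \<open>Converse of the extraction above: polynomial identities and a few leading coefficients
  produce the identity of functions and the limit at \<open>\<infinity>\<^sub>1\<close>.\<close>

lemma jfrac_orbitI: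
  assumes g: "g \<ge> 1" and A: "degree A = g + 1" "lead_coeff A = 1" "coeff A g = 0"
    and B: "degree B \<le> g"
    and P: "\<And>n. degree (P n) \<le> g + 1" "\<And>n. coeff (P n) (g + 1) = 1" "\<And>n. coeff (P n) g = 0"
    and Q: "\<And>n. degree (Q n) \<le> g" "\<And>n. coeff (Q n) g = u n" "\<And>n. coeff (Q n) (g - 1) = - u n * v n"
    and u: "\<And>n. u n \<noteq> 0" "\<And>n. u n * u (n - 1) = - 4 * d n"
    and norm: "\<And>n. (P n)\<^sup>2 + Q n * Q (n - 1) = A\<^sup>2 + 4 * B"
    and rec: "\<And>n. P n + P (n + 1) = smult (2 / u n) ([:v n, 1:] * Q n)"
  shows "jfrac_orbit g A B P Q u d v"
  unfolding jfrac_orbit_def Let_def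
proof (intro allI conjI impI)
  fix n
  let ?C = "completed_curve g (A\<^sup>2 + 4 * B)"
  show "u n \<noteq> 0" by (rule u)
  have dA: "degree (P n - A) \<le> g - 1"
  proof (intro degree_le allI impI)
    fix i assume "g - 1 < i"
    then consider "i = g" | "i = g + 1" | "i > g + 1" using g by linarith
    then show "coeff (P n - A) i = 0"
      using P[of n] A by cases (auto simp: coeff_eq_0)
  qed
  \<comment> \<open>Comparing coefficients of \<open>X^(2g)\<close> gives \<open>d n\<close>: the
    left factor has degree at most \<open>g - 1\<close>, the right one has leading coefficient 2,
    and \<open>B\<close> is too small in degree to contribute.\<close>
  have e: "(P n - A) * (P n + A) = 4 * B - Q n * Q (n - 1)"
    using norm[of n] by (simp add: power2_eq_square algebra_simps)
  have i: "2 * g = (g - 1) + (g + 1)" using g by auto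
  have "coeff ((P n - A) * (P n + A)) (2 * g) = coeff (P n - A) (g - 1) * coeff (P n + A) (g + 1)"
    unfolding i using dA P(1)[of n] A by (intro coeff_mult_add_le degree_add_le) auto
  moreover have "coeff (Q n * Q (n - 1)) (2 * g) = u n * u (n - 1)"
    unfolding mult_2 using coeff_mult_add_le[OF Q(1)[of n] Q(1)[of "n - 1"]]
    by (simp only: Q(2))
  moreover have "coeff (4 * B) (2 * g) = 0"
  proof -
    have "coeff B (2 * g) = 0" using B g by (intro coeff_eq_0) auto
    then show ?thesis by (simp add: numeral_poly)
  qed
  ultimately have "coeff (P n - A) (g - 1) * 2 = 2 * d n * 2"
    using A P(2) u(2) unfolding e by simp
  then have dn: "coeff (P n - A) (g - 1) = 2 * d n"
    by (simp only: mult_cancel_right) simp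
  show "coeff (P n - (A + monom (2 * d n) (g - 1))) i = 0" if "i \<ge> g - 1" for i
  proof (cases "i = g - 1")
    case True
    then show ?thesis using dn by (simp add: diff_eq_eq add.commute)
  next
    case False
    then show ?thesis using that dA coeff_eq_0[of "P n - A" i] by simp
  qed
  show "coeff (Q n - smult (u n) (monom 1 g - monom (v n) (g - 1))) i = 0" if "i \<ge> g - 1" for i
  proof -
    have "i = g - 1 \<or> i = g \<or> i > g" using that by linarith
    then consider "i = g - 1" | "i = g" | "i > g" by blast
    then show ?thesis
      using Q[of n] g by cases (auto simp: coeff_eq_0)
  qed
  show "(P n)\<^sup>2 + Q n * Q (n - 1) = A\<^sup>2 + 4 * B" by (rule norm)
  have nz: "Q n \<noteq> 0" "Q (n + 1) \<noteq> 0"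
    using Q(2)[of n] Q(2)[of "n + 1"] u(1)[of n] u(1)[of "n + 1"] by auto
  show sf: "same_fun ?C (quad_fun (P n) (Q n))
      (\<lambda>p. jfrac_alpha (u n) (v n) p + 1 / quad_fun (P (n + 1)) (Q (n + 1)) p)"
  proof (rule same_funI[of "Q n * Q (n + 1)"])
    show "Q n * Q (n + 1) \<noteq> 0" using nz by simp
    fix x y assume y: "y\<^sup>2 = poly (A\<^sup>2 + 4 * B) x" and x: "poly (Q n * Q (n + 1)) x \<noteq> 0"
    let ?P = "poly (P n) x" and ?P' = "poly (P (n + 1)) x"
    let ?Q = "poly (Q n) x" and ?Q' = "poly (Q (n + 1)) x"
    have x: "?Q \<noteq> 0" "?Q' \<noteq> 0" using x by auto
    have n': "(y + ?P') * (y - ?P') = ?Q * ?Q'"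
      using arg_cong[OF norm[of "n + 1"], of "\<lambda>p. poly p x"] y
      by (simp add: power2_eq_square algebra_simps)
    then have nz': "y + ?P' \<noteq> 0" using x by auto
    have "?P + ?P' = 2 * (x + v n) / u n * ?Q"
      using arg_cong[OF rec[of n], of "\<lambda>p. poly p x"] by (simp add: algebra_simps add_divide_distrib)
    then have "(?P + ?P') / ?Q = 2 * (x + v n) / u n"
      using x by (simp add: divide_eq_eq)
    moreover have "?Q' / (y + ?P') = (y - ?P') / ?Q"
      using n' nz' x by (simp add: frac_eq_eq mult.commute)
    moreover have "(y + ?P) / ?Q = (?P + ?P') / ?Q + (y - ?P') / ?Q"
      by (simp flip: add_divide_distrib)
    ultimately have "(y + ?P) / ?Q = 2 * (x + v n) / u n + 1 / ((y + ?P') / ?Q')"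
      by (simp only: divide_divide_eq_right mult_1)
    then show "quad_fun (P n) (Q n) (Affine x y) =
        jfrac_alpha (u n) (v n) (Affine x y) + 1 / quad_fun (P (n + 1)) (Q (n + 1)) (Affine x y)"
      by (simp only: quad_fun_def jfrac_alpha_def xco_def yco_def aff_coords.simps fst_conv snd_conv)
  qed
  have "degree (P (n + 1)) = g + 1"
    using P(1,2)[of "n + 1"] by (intro antisym le_degree) auto
  then have "((\<lambda>p. 1 / quad_fun (P (n + 1)) (Q (n + 1)) p) \<longlongrightarrow> 0) (at_infty1 g ?C)"
    using P(2)[of "n + 1"] Q(1)[of "n + 1"] by (intro inverse_quad_fun_at_infty1) auto
  \<comment> \<open>Near \<open>\<infinity>\<^sub>1\<close> the remainder
    \<open>Y_n - \<alpha>_n\<close> equals \<open>1 / Y_(n+1)\<close>, whose limit has just been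
    found.\<close>
  then show "((\<lambda>p. quad_fun (P n) (Q n) p - jfrac_alpha (u n) (v n) p) \<longlongrightarrow> 0) (at_infty1 g ?C)"
    by (rule Lim_transform_eventually)
      (use same_fun_eventually_at_infty1[OF sf, of g] in eventually_elim, simp)
qed

subsection \<open>From the Volterra map to the J-fraction map\<close>

text \<open>Dividing by the non-zero previous value solves the recurrence upwards and downwards from
  \<open>m\<close>. It supplies the prefactors with \<open>u n * u (n - 1) = - 4 * d n\<close>; the
  free value \<open>a\<close> is the arbitrary constant of the continued fraction.\<close>

lemma int_recurrence_exists:
  fixes e :: "int \<Rightarrow> complex"
  assumes "\<And>n. e n \<noteq> 0" "a \<noteq> 0"
  obtains u where "u m = a" "\<And>n. u n \<noteq> 0" "\<And>n. u n * u (n - 1) = e n"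
proof -
  define U where "U = rec_nat a (\<lambda>k z. e (m + int k + 1) / z)"
  define D where "D = rec_nat a (\<lambda>k z. e (m - int k) / z)"
  have U: "U 0 = a" "\<And>k. U (Suc k) = e (m + int k + 1) / U k" by (simp_all add: U_def)
  have D: "D 0 = a" "\<And>k. D (Suc k) = e (m - int k) / D k" by (simp_all add: D_def)
  have U0: "U k \<noteq> 0" for k by (induction k) (use U assms in auto)
  have D0: "D k \<noteq> 0" for k by (induction k) (use D assms in auto)
  define u where "u n = (if n \<ge> m then U (nat (n - m)) else D (nat (m - n)))" for n
  have "u n * u (n - 1) = e n" for n
  proof (cases "n > m")
    case True
    define k where "k = nat (n - 1 - m)"
    have "nat (n - m) = Suc k" "nat (n - 1 - m) = k" "n = m + int k + 1"
      using True by (auto simp: k_def)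
    then show ?thesis using True U(2)[of k] U0[of k] by (simp add: u_def)
  next
    case False
    define k where "k = nat (m - n)"
    have k: "nat (m - (n - 1)) = Suc k" "nat (m - n) = k" "n = m - int k"
      using False by (auto simp: k_def)
    have "u n = D k"
      using False k U(1) D(1) by (cases "n = m") (auto simp: u_def)
    moreover have "u (n - 1) = D (Suc k)"
      using False k by (simp add: u_def)
    ultimately show ?thesis using D(2)[of k] D0[of k] k by simp
  qed
  moreover have "u m = a" by (simp add: u_def U)
  moreover have "u n \<noteq> 0" for n by (simp add: u_def U0 D0)
  ultimately show ?thesis using that by blast
qed

section \<open>A generic Volterra orbit and its low-order coefficients\<close>

locale volterra_spectral =
  fixes g :: nat and f :: "complex poly" and P Q R :: "int \<Rightarrow> complex poly"
  assumes orbit: "generic_volterra_orbit g P Q R"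
    and spectral: "(P n)\<^sup>2 + Q n * R n = f"
    and g: "g \<ge> 1"
    and deg_f: "degree f \<le> 2 * g + 1"
    and lead_f: "coeff f (2 * g + 1) \<noteq> 0"
begin

abbreviation w :: "int \<Rightarrow> complex" where "w \<equiv> volterra_w R"

text \<open>The translation that removes the \<open>X^g\<close> term from the numerators
  \<open>PJ\<close> and hence from \<open>A\<close>.\<close>

definition shift :: complex where "shift = coeff f 1 / (2 * of_nat g + 2)"

lemma coeff_f_1: "coeff f 1 = 2 * (of_nat g + 1) * shift"
proof -
  have "of_nat (2 * g + 2) \<noteq> (0 :: complex)" by (simp only: of_nat_eq_0_iff)
  then have "2 * of_nat g + 2 \<noteq> (0 :: complex)" by (simp add: add.commute)
  then show ?thesis by (simp add: shift_def distrib_left)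
qed

lemma w_nonzero: "w n \<noteq> 0"
  using orbit by (auto simp: generic_volterra_orbit_def)

lemma volterra_coeffs:
  "coeff (P n) 0 = 1" "degree (P n) \<le> g" "coeff (Q n) 0 = 2" "degree (Q n) \<le> g"
  "coeff (R n) 0 = 0" "coeff (R n) 1 = - 2 * w n"
  using orbit by (auto simp: generic_volterra_orbit_def volterra_space_def volterra_w_def)

text \<open>The division in the map is exact because \<open>2P - Q + R\<close> has constant term
  \<open>2 - 2 + 0\<close>. The \<open>w\<close> computed from triplet \<open>n\<close> is
  \<open>w (n + 1)\<close>, since \<open>Q n\<close> has constant term 2.\<close>

lemma volterra_step:
  "P (n + 1) = Q n - P n"
  "R (n + 1) = monom (- w (n + 1)) 1 * Q n"
  "monom (- w (n + 1)) 1 * Q (n + 1) = 2 * P n - Q n + R n"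
  "w (n + 1) = - (2 * coeff (P n) 1 - coeff (Q n) 1 + coeff (R n) 1) / 2"
proof -
  define z where "z = - (2 * coeff (P n) 1 - coeff (Q n) 1 + coeff (R n) 1) / 2"
  let ?N = "2 * P n - Q n + R n"
  have s: "P (n + 1) = Q n - P n" "Q (n + 1) = ?N div monom (- z) 1" "R (n + 1) = monom (- z) 1 * Q n"
    using orbit by (auto simp: generic_volterra_orbit_def volterra_map_def z_def Let_def)
  have mz: "monom (- z) 1 = smult (- z) [:0, 1:]" by (simp add: monom_altdef)
  have "coeff (R (n + 1)) 1 = - 2 * z"
    unfolding s mz using volterra_coeffs(3)[of n] by simp
  then have zw: "z = w (n + 1)" using volterra_coeffs(6)[of "n + 1"] by simp
  have "poly ?N 0 = 2 * coeff (P n) 0 - coeff (Q n) 0 + coeff (R n) 0"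
    by (simp flip: poly_0_coeff_0)
  then have "poly ?N 0 = 0" by (simp add: volterra_coeffs)
  then have "[:0, 1:] dvd ?N" using poly_eq_0_iff_dvd[of ?N 0] by simp
  then have "monom (- z) 1 dvd ?N"
    unfolding mz using w_nonzero[of "n + 1"] zw by (intro smult_dvd) auto
  then have "monom (- z) 1 * Q (n + 1) = ?N" by (simp add: s)
  then show "P (n + 1) = Q n - P n" "R (n + 1) = monom (- w (n + 1)) 1 * Q n"
    "monom (- w (n + 1)) 1 * Q (n + 1) = ?N"
    "w (n + 1) = - (2 * coeff (P n) 1 - coeff (Q n) 1 + coeff (R n) 1) / 2"
    using s zw z_def by simp_all
qed

lemma poly_volterra_step:
  "poly (P (n + 1)) x = poly (Q n) x - poly (P n) x"
  "poly (R (n + 1)) x = - w (n + 1) * x * poly (Q n) x"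
  "- w (n + 1) * x * poly (Q (n + 1)) x = 2 * poly (P n) x - poly (Q n) x + poly (R n) x"
  "(poly (P n) x)\<^sup>2 + poly (Q n) x * poly (R n) x = poly f x"
  using arg_cong[OF volterra_step(1)[of n], of "\<lambda>p. poly p x"]
    arg_cong[OF volterra_step(2)[of n], of "\<lambda>p. poly p x"]
    arg_cong[OF volterra_step(3)[of n], of "\<lambda>p. poly p x"]
    arg_cong[OF spectral[of n], of "\<lambda>p. poly p x"]
  by (simp_all add: poly_monom)

text \<open>Linear coefficient of the spectral equation.\<close>

lemma coeff_P_1: "coeff (P n) 1 = coeff f 1 / 2 + 2 * w n"
proof -
  have "coeff f 1 = coeff (P n * P n + Q n * R n) 1"
    using spectral[of n] by (simp add: power2_eq_square)
  also have "\<dots> = 2 * coeff (P n) 1 - 4 * w n"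
    using volterra_coeffs[of n] by (simp add: coeff_mult)
  finally show ?thesis by (simp add: field_simps)
qed

lemma coeff_Q_1: "coeff (Q n) 1 = coeff f 1 + 2 * w n + 2 * w (n + 1)"
proof -
  have "2 * w (n + 1) = - 2 * coeff (P n) 1 + coeff (Q n) 1 - coeff (R n) 1"
    using volterra_step(4)[of n] by (simp add: field_simps)
  then show ?thesis using coeff_P_1[of n] volterra_coeffs(6)[of n] by (simp add: field_simps)
qed

text \<open>Contracting two steps of the continued fraction of \<open>F\<^sub>n\<close> gives
  \<open>F\<^sub>n/x - w\<^sub>n = 1/x - w\<^sub>n - w\<^sub>n\<^sub>+\<^sub>1 - w\<^sub>n\<^sub>+\<^sub>1 w\<^sub>n\<^sub>+\<^sub>2 / (F\<^sub>n\<^sub>+\<^sub>2/x - w\<^sub>n\<^sub>+\<^sub>2)\<close>; the polynomials below are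
  the numerator and denominator of the left-hand side.\<close>

definition PJ :: "int \<Rightarrow> complex poly" where
  "PJ j = flip_poly shift (g + 1) (P (2 * j - 2) - monom (w (2 * j - 2)) 1 * Q (2 * j - 2))"

definition QJ :: "(int \<Rightarrow> complex) \<Rightarrow> int \<Rightarrow> complex poly" where
  "QJ u j = smult (u j / 2) (flip_poly shift g (Q (2 * j - 2)))"

text \<open>Since \<open>Y_1\<close> corresponds to \<open>F_0\<close> and each J-step to two
  Volterra steps, the J-index \<open>j\<close> is paired with the Volterra index
  \<open>2 * j - 2\<close>.\<close>

definition dJ :: "int \<Rightarrow> complex" where
  "dJ j = w (2 * j - 3) * w (2 * j - 2)"

definition vJ :: "int \<Rightarrow> complex" where
  "vJ j = - w (2 * j - 2) - w (2 * j - 1) - shift"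

lemma degree_PJ_aux: "degree (P n - monom (w n) 1 * Q n) \<le> g + 1"
proof (rule degree_diff_le)
  show "degree (P n) \<le> g + 1" using volterra_coeffs(2)[of n] by simp
  show "degree (monom (w n) 1 * Q n) \<le> g + 1"
    using degree_mult_le[of "monom (w n) 1" "Q n"] degree_monom_le[of "w n" 1] volterra_coeffs(4)[of n]
    by linarith
qed

section \<open>Coefficients and identities of the transported polynomials\<close>

lemma poly_PJ:
  assumes "x \<noteq> 0"
  shows "poly (PJ j) (1 / x + shift) =
    (poly (P (2 * j - 2)) x - w (2 * j - 2) * x * poly (Q (2 * j - 2)) x) / x ^ (g + 1)"
  unfolding PJ_def using assms
  by (subst poly_flip[OF degree_PJ_aux]) (auto simp: poly_monom power_divide)

lemma poly_QJ:
  assumes "x \<noteq> 0"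
  shows "poly (QJ u j) (1 / x + shift) = u j / 2 * poly (Q (2 * j - 2)) x / x ^ g"
  unfolding QJ_def using assms
  by (simp, subst poly_flip[OF volterra_coeffs(4)]) (auto simp: power_divide)

text \<open>As \<open>x\<close> runs over the non-zero numbers, \<open>X\<close> misses only
  \<open>shift\<close>, so identities in \<open>X\<close> can be checked in the variable
  \<open>x\<close>.\<close>

lemma poly_eqI_flip:
  fixes p q :: "complex poly"
  assumes "\<And>x. x \<noteq> 0 \<Longrightarrow> poly p (1 / x + shift) = poly q (1 / x + shift)"
  shows "p = q"
proof (rule poly_eqI_cofinite[of "{shift}"])
  fix X assume "X \<notin> {shift}"
  then show "poly p X = poly q X" using assms[of "1 / (X - shift)"] by simp
qed simp

lemma PJ_coeffs:
  "degree (PJ j) \<le> g + 1" "coeff (PJ j) (g + 1) = 1" "coeff (PJ j) g = 0"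
proof -
  show "degree (PJ j) \<le> g + 1" unfolding PJ_def by (rule degree_flip)
  let ?n = "2 * j - 2"
  have m: "monom (w ?n) 1 = smult (w ?n) [:0, 1:]" by (simp add: monom_altdef)
  \<comment> \<open>Subtracting \<open>w_n x Q_n\<close>, with \<open>Q_n(0) = 2\<close>, cancels
    the \<open>2 w_n\<close> in the linear coefficient of \<open>P_n\<close>. What remains is half
    of \<open>coeff f 1\<close>, the same for every \<open>n\<close>, so one translation serves the
    whole orbit.\<close>
  have c: "coeff (P ?n - monom (w ?n) 1 * Q ?n) 0 = 1"
      "coeff (P ?n - monom (w ?n) 1 * Q ?n) 1 = coeff f 1 / 2"
    unfolding m using volterra_coeffs[of ?n] coeff_P_1[of ?n] by simp_all
  show "coeff (PJ j) (g + 1) = 1" unfolding PJ_def coeff_flip by (rule c)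
  have "coeff (PJ j) g = coeff f 1 / 2 - of_nat (g + 1) * shift"
    using coeff_flip_pred[of "g + 1" shift "P ?n - monom (w ?n) 1 * Q ?n"] unfolding PJ_def c by simp
  then show "coeff (PJ j) g = 0" unfolding coeff_f_1 by (simp add: add.commute)
qed

lemma QJ_coeffs:
  "degree (QJ u j) \<le> g" "coeff (QJ u j) g = u j" "coeff (QJ u j) (g - 1) = - u j * vJ j"
proof -
  let ?n = "2 * j - 2"
  show "degree (QJ u j) \<le> g"
    unfolding QJ_def using degree_flip degree_smult_le order_trans by blast
  \<comment> \<open>Reversal turns the constant term 2 of \<open>Q\<close> into the leading
    coefficient; the factor \<open>u j / 2\<close> normalises it.\<close>
  show "coeff (QJ u j) g = u j"
    unfolding QJ_def by (simp add: coeff_flip volterra_coeffs)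
  have "coeff (QJ u j) (g - 1) = u j / 2 * (coeff (Q ?n) 1 - of_nat g * shift * 2)"
    using coeff_flip_pred[OF g, of shift "Q ?n"] volterra_coeffs(3)[of ?n] by (simp add: QJ_def)
  \<comment> \<open>Here \<open>coeff f 1 - 2 g shift = 2 shift\<close>, which accounts for the
    \<open>shift\<close> in \<open>vJ\<close>.\<close>
  also have "\<dots> = - u j * vJ j"
    using coeff_Q_1[of ?n] unfolding coeff_f_1 vJ_def by (simp add: field_simps)
  finally show "coeff (QJ u j) (g - 1) = - u j * vJ j" .
qed

lemma PJ_QJ_norm:
  assumes "u j * u (j - 1) = - 4 * dJ j"
  shows "(PJ j)\<^sup>2 + QJ u j * QJ u (j - 1) = flip_poly shift (2 * g + 2) f"
proof (rule poly_eqI_flip)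
  fix x :: complex assume x: "x \<noteq> 0"
  define n where "n = 2 * j - 2"
  let ?p = "poly (P n) x" and ?q = "poly (Q n) x" and ?q' = "poly (Q (n - 1)) x" and ?q'' = "poly (Q (n - 2)) x"
  have i: "2 * (j - 1) - 2 = n - 2" "2 * j - 3 = n - 1" by (simp_all add: n_def)
  have s1: "?p = ?q' - poly (P (n - 1)) x" "poly (R n) x = - w n * x * ?q'"
    "- w n * x * ?q = 2 * poly (P (n - 1)) x - ?q' + poly (R (n - 1)) x"
    "?p\<^sup>2 + ?q * poly (R n) x = poly f x"
    using poly_volterra_step[of "n - 1" x] poly_volterra_step(4)[of n x] by simp_all
  have s2: "poly (R (n - 1)) x = - w (n - 1) * x * ?q''"
    using poly_volterra_step(2)[of "n - 2" x] by simp
  \<comment> \<open>The steps give \<open>Q_(n-1) = 2 P_n - w_n x Q_n + w_(n-1) x Q_(n-2)\<close>;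
    inserting this into \<open>f = P_n^2 - w_n x Q_n Q_(n-1)\<close> completes the square.\<close>
  have "poly f x = (?p - w n * x * ?q)\<^sup>2 - w (n - 1) * w n * x\<^sup>2 * ?q * ?q''"
    using s1 s2 by algebra
  moreover have "poly (QJ u j) (1 / x + shift) * poly (QJ u (j - 1)) (1 / x + shift)
      = - (w (n - 1) * w n * x\<^sup>2 * ?q * ?q'') / x ^ (2 * g + 2)"
  proof -
    have "poly (QJ u j) (1 / x + shift) * poly (QJ u (j - 1)) (1 / x + shift)
       = (u j * u (j - 1)) / 4 * ?q * ?q'' / (x ^ g * x ^ g)"
      by (simp add: poly_QJ[OF x] i flip: n_def)
    also have "\<dots> = - (w (n - 1) * w n * x\<^sup>2 * ?q * ?q'') / x ^ (2 * g + 2)"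
    proof -
      have "dJ j = w (n - 1) * w n"
        unfolding dJ_def i(2) by (simp only: n_def)
      moreover have "x ^ (2 * g + 2) = x\<^sup>2 * (x ^ g * x ^ g)"
        unfolding mult_2[of g] power_add by (rule mult.commute)
      ultimately show ?thesis
        using x unfolding assms by (simp add: divide_simps)
    qed
    finally show ?thesis .
  qed
  moreover have "(poly (PJ j) (1 / x + shift))\<^sup>2 = (?p - w n * x * ?q)\<^sup>2 / x ^ (2 * g + 2)"
    by (simp only: poly_PJ[OF x] square_div_power n_def)
  moreover have "poly (flip_poly shift (2 * g + 2) f) (1 / x + shift) = poly f x / x ^ (2 * g + 2)"
    using x deg_f poly_flip[of f "2 * g + 2" "1 / x + shift" shift] by (simp add: power_divide)
  ultimately show "poly ((PJ j)\<^sup>2 + QJ u j * QJ u (j - 1)) (1 / x + shift) =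
      poly (flip_poly shift (2 * g + 2) f) (1 / x + shift)"
    by (simp only: poly_add poly_mult poly_power) (simp add: diff_divide_distrib)
qed

lemma PJ_QJ_rec:
  assumes "u j \<noteq> 0"
  shows "PJ j + PJ (j + 1) = smult (2 / u j) ([:vJ j, 1:] * QJ u j)"
proof (rule poly_eqI_flip)
  fix x :: complex assume x: "x \<noteq> 0"
  define n where "n = 2 * j - 2"
  let ?p = "poly (P n) x" and ?q = "poly (Q n) x" and ?p2 = "poly (P (n + 2)) x" and ?q2 = "poly (Q (n + 2)) x"
  have PJ: "poly (PJ j) (1 / x + shift) = (?p - w n * x * ?q) / x ^ (g + 1)"
      "poly (PJ (j + 1)) (1 / x + shift) = (?p2 - w (n + 2) * x * ?q2) / x ^ (g + 1)"
    using poly_PJ[OF x, of j] poly_PJ[OF x, of "j + 1"] by (simp_all add: n_def)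
  have QJ: "poly (QJ u j) (1 / x + shift) = u j / 2 * ?q / x ^ g" "vJ j = - w n - w (n + 1) - shift"
    by (simp_all add: poly_QJ[OF x] vJ_def n_def)
  have s1: "poly (P (n + 1)) x = ?q - ?p" "poly (R (n + 1)) x = - w (n + 1) * x * ?q"
    "?p2 = poly (Q (n + 1)) x - poly (P (n + 1)) x"
    "- w (n + 2) * x * ?q2 = 2 * poly (P (n + 1)) x - poly (Q (n + 1)) x + poly (R (n + 1)) x"
    using poly_volterra_step[of n x] poly_volterra_step[of "n + 1" x] by (simp_all add: add.assoc)
  \<comment> \<open>The second summand is
    \<open>P_(n+1) + R_(n+1) = Q_n - P_n - w_(n+1) x Q_n\<close>. After division by
    \<open>x\<close>, the factor of \<open>Q_n\<close> becomes \<open>X + vJ j\<close>.\<close>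
  have "(?p - w n * x * ?q) + (?p2 - w (n + 2) * x * ?q2) = (1 - (w n + w (n + 1)) * x) * ?q"
    using s1 by algebra
  then have "poly (PJ j + PJ (j + 1)) (1 / x + shift) = (1 - (w n + w (n + 1)) * x) * ?q / x ^ (g + 1)"
    by (simp only: poly_add PJ flip: add_divide_distrib)
  also have "\<dots> = (1 / x - w n - w (n + 1)) * ?q / x ^ g"
    using x by (simp add: field_simps)
  also have "\<dots> = poly (smult (2 / u j) ([:vJ j, 1:] * QJ u j)) (1 / x + shift)"
    using assms by (simp add: QJ algebra_simps add_divide_distrib diff_divide_distrib)
  finally show "poly (PJ j + PJ (j + 1)) (1 / x + shift) =
      poly (smult (2 / u j) ([:vJ j, 1:] * QJ u j)) (1 / x + shift)" .
qed

lemma dJ_nonzero: "dJ j \<noteq> 0"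
  by (simp add: dJ_def w_nonzero)

text \<open>The factor \<open>u (j + 1) / 2\<close> undoes the normalisation of \<open>QJ\<close>.
  The identity is checked away from \<open>x = 0\<close> and the zeros of
  \<open>Q (2 * j)\<close>.\<close>

lemma same_fun_PJ_QJ:
  assumes "u (j + 1) \<noteq> 0"
  shows "same_fun (completed_curve g f)
    (\<lambda>p. quad_fun (P (2 * j)) (Q (2 * j)) p / xco p - w (2 * j))
    (\<lambda>p. u (j + 1) / 2 * quad_fun (PJ (j + 1)) (QJ u (j + 1)) (curve_flip shift g p))"
proof (rule same_funI[of "[:0, 1:] * Q (2 * j)"])
  show "[:0, 1:] * Q (2 * j) \<noteq> 0"
    using volterra_coeffs(3)[of "2 * j"] by auto
  fix x y assume "y\<^sup>2 = poly f x" "poly ([:0, 1:] * Q (2 * j)) x \<noteq> 0"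
  then have x: "x \<noteq> 0" and q: "poly (Q (2 * j)) x \<noteq> 0" by auto
  let ?p = "poly (P (2 * j)) x" and ?q = "poly (Q (2 * j)) x"
  have "u (j + 1) / 2 * quad_fun (PJ (j + 1)) (QJ u (j + 1)) (curve_flip shift g (Affine x y)) =
     u (j + 1) / 2 * (((y + (?p - w (2 * j) * x * ?q)) / x ^ (g + 1)) / (u (j + 1) / 2 * ?q / x ^ g))"
    using x poly_PJ[OF x, of "j + 1"] poly_QJ[OF x, of u "j + 1"]
    by (simp add: quad_fun_def xco_def yco_def add_divide_distrib)
  also have "\<dots> = (y + (?p - w (2 * j) * x * ?q)) / (x * ?q)"
  proof -
    have *: "c * ((z / x ^ (g + 1)) / (c * ?q / x ^ g)) = z / (x * ?q)" if "c \<noteq> 0" for c z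
      using that x by simp
    show ?thesis by (rule *) (use assms in simp)
  qed
  also have "\<dots> = (y + ?p) / ?q / x - w (2 * j)"
    using x q by (simp add: field_simps)
  finally show "quad_fun (P (2 * j)) (Q (2 * j)) (Affine x y) / xco (Affine x y) - w (2 * j) =
      u (j + 1) / 2 * quad_fun (PJ (j + 1)) (QJ u (j + 1)) (curve_flip shift g (Affine x y))"
    by (simp add: quad_fun_def xco_def yco_def)
qed

text \<open>The norm identity shows that \<open>PJ 1\<close> is a square root of the flipped
  \<open>f\<close> up to degree \<open>2 * g\<close>. Correcting its lower coefficients gives
  \<open>A\<close>, and \<open>B\<close> is non-zero because the flipped \<open>f\<close> is not a
  square.\<close>

lemma jfrac_curve_exists:
  obtains A B where "jfrac_curve_data g A B" "A\<^sup>2 + 4 * B = flip_poly shift (2 * g + 2) f"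
proof -
  let ?F = "flip_poly shift (2 * g + 2) f"
  \<comment> \<open>The starting value 1 is arbitrary: any solution bounds the degree of
    \<open>?F - (PJ 1)\<^sup>2\<close>.\<close>
  obtain u where u: "u (1::int) = 1" "\<And>n. u n \<noteq> 0" "\<And>n. u n * u (n - 1) = - 4 * dJ n"
    using int_recurrence_exists[of "\<lambda>n. - 4 * dJ n" 1 1] dJ_nonzero by auto
  have "?F - (PJ 1)\<^sup>2 = QJ u 1 * QJ u (1 - 1)"
    using PJ_QJ_norm[of u 1, OF u(3)] by (simp add: algebra_simps)
  then have "degree (?F - (PJ 1)\<^sup>2) \<le> 2 * g"
    using degree_mult_le[of "QJ u 1" "QJ u (1 - 1)"] QJ_coeffs(1)[of u 1] QJ_coeffs(1)[of u "1 - 1"]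
    by simp
  moreover have "degree (PJ 1) = g + 1"
    using PJ_coeffs(1,2)[of 1] by (intro antisym le_degree) auto
  moreover from this have "lead_coeff (PJ 1) = 1" using PJ_coeffs(2)[of 1] by simp
  ultimately obtain A where A: "degree A = g + 1" "lead_coeff A = 1" "coeff A g = 0" "degree (?F - A\<^sup>2) \<le> g"
    using monic_sqrt_approx[of "PJ 1" g ?F] PJ_coeffs(3)[of 1] by metis
  define B where "B = smult (1 / 4) (?F - A\<^sup>2)"
  have "4 * B = smult 4 B" by (simp add: numeral_poly)
  then have AB: "A\<^sup>2 + 4 * B = ?F" by (simp add: B_def)
  have "coeff f (Suc (2 * g + 1)) = 0" using deg_f by (intro coeff_eq_0) auto
  then have "?F \<noteq> A\<^sup>2" using flip_not_square[of f "2 * g + 1" shift A] lead_f by simp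
  then have "B \<noteq> 0" using AB by auto
  moreover have "degree B \<le> g" using A(4) unfolding B_def by simp
  ultimately have "jfrac_curve_data g A B"
    unfolding jfrac_curve_data_def using A by blast
  then show ?thesis using AB that by blast
qed

lemma jfrac_orbit_exists:
  assumes AB: "jfrac_curve_data g A B" "A\<^sup>2 + 4 * B = flip_poly shift (2 * g + 2) f"
    and "s \<noteq> 0"
  obtains u where "jfrac_orbit g A B PJ (QJ u) u dJ vJ" "u 1 = s"
proof -
  obtain u where u: "u (1::int) = s" "\<And>n. u n \<noteq> 0" "\<And>n. u n * u (n - 1) = - 4 * dJ n"
    using int_recurrence_exists[of "\<lambda>n. - 4 * dJ n" s 1] dJ_nonzero assms(3) by auto
  have "jfrac_orbit g A B PJ (QJ u) u dJ vJ"
    using AB u g PJ_coeffs QJ_coeffs PJ_QJ_norm[of u] PJ_QJ_rec[of u]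
    by (intro jfrac_orbitI) (auto simp: jfrac_curve_data_def)
  then show ?thesis using that u by blast
qed

end

section \<open>The corresponding orbits: existence for every prefactor, and uniqueness\<close>

theorem proposition5p8:
  fixes g :: nat and c :: "nat \<Rightarrow> complex" and f :: "complex poly"
    and P Q R :: "int \<Rightarrow> complex poly"
  assumes "g \<ge> 1"
    and "f = 1 + (\<Sum>i=1..2*g+1. monom (c i) i)"
    and "squarefree f"
    and "c (2*g+1) \<noteq> 0"
    and "generic_volterra_orbit g P Q R"
    and "\<forall>n. (P n)\<^sup>2 + Q n * R n = f"
  defines "w \<equiv> volterra_w R"
    and "F \<equiv> \<lambda>n. quad_fun (P n) (Q n)"
    and "\<Gamma> \<equiv> completed_curve g f"
  shows "\<exists>A B \<phi>.
    jfrac_curve_data g A B \<and>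
    curve_iso g \<Gamma> (completed_curve g (A\<^sup>2 + 4 * B)) \<phi> \<and>
    (\<forall>x y. Affine x y \<in> \<Gamma> \<and> x \<noteq> 0 \<longrightarrow>
       \<phi> (Affine x y) = Affine (1 / x + c 1 / (2 * of_nat g + 2)) (y / x ^ (g + 1))) \<and>
    (\<forall>s0. s0 \<noteq> 0 \<longrightarrow> (\<exists>PJ QJ u d v.
       jfrac_orbit g A B PJ QJ u d v \<and> s0 = u 1 / 2 \<and>
       same_fun \<Gamma> (\<lambda>p. F 0 p / xco p - w 0) (\<lambda>p. s0 * quad_fun (PJ 1) (QJ 1) (\<phi> p)))) \<and>
    (\<forall>PJ QJ u d v.
       jfrac_orbit g A B PJ QJ u d v \<and>
       same_fun \<Gamma> (\<lambda>p. F 0 p / xco p - w 0) (\<lambda>p. u 1 / 2 * quad_fun (PJ 1) (QJ 1) (\<phi> p)) \<longrightarrow>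
       (\<forall>j. d (j + 1) = w (2 * j - 1) * w (2 * j) \<and>
            v (j + 1) = - w (2 * j) - w (2 * j + 1) - c 1 / (2 * (of_nat g + 1))) \<and>
       (\<forall>j. same_fun \<Gamma> (\<lambda>p. F (2 * j) p / xco p - w (2 * j))
              (\<lambda>p. u (j + 1) / 2 * quad_fun (PJ (j + 1)) (QJ (j + 1)) (\<phi> p))))"
proof -
  define a where "a = c 1 / (2 * of_nat g + 2)"
  have coeff_f: "coeff f i = (if i = 0 then 1 else if i \<le> 2 * g + 1 then c i else 0)" for i
    unfolding assms(2) by (auto simp: coeff_sum)
  have "degree f \<le> 2 * g + 1"
    by (rule degree_le) (simp add: coeff_f)
  then interpret volterra_spectral g f P Q R
    using assms(1,4,5,6) by unfold_locales (auto simp: coeff_f)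
  have shift: "shift = a" by (simp add: shift_def coeff_f a_def)
  let ?F = "flip_poly shift (2 * g + 2) f"
  let ?\<phi> = "curve_flip shift g"
  obtain A B where data: "jfrac_curve_data g A B" and AB: "A\<^sup>2 + 4 * B = ?F"
    by (rule jfrac_curve_exists)
  have iso: "curve_iso g \<Gamma> (completed_curve g ?F) ?\<phi>"
    unfolding \<Gamma>_def using deg_f by (intro curve_flip_iso) simp
  \<comment> \<open>Non-squareness with \<open>A = 0\<close>; this makes \<open>Y\<close> non-zero
    at almost all points, as the comparison of functions requires.\<close>
  have F_nz: "?F \<noteq> 0"
    using flip_not_square[of f "2 * g + 1" shift 0] lead_f by (simp add: coeff_f)
  have F_fun: "same_fun \<Gamma> (\<lambda>p. F (2 * j) p / xco p - w (2 * j))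
      (\<lambda>p. u (j + 1) / 2 * quad_fun (PJ (j + 1)) (QJ u (j + 1)) (?\<phi> p))"
    if "u (j + 1) \<noteq> 0" for u j
    using same_fun_PJ_QJ[of u j, OF that] by (simp only: \<Gamma>_def F_def w_def)
  have existence: "\<exists>PJ QJ u d v. jfrac_orbit g A B PJ QJ u d v \<and> s0 = u 1 / 2 \<and>
      same_fun \<Gamma> (\<lambda>p. F 0 p / xco p - w 0) (\<lambda>p. s0 * quad_fun (PJ 1) (QJ 1) (?\<phi> p))"
    if "s0 \<noteq> 0" for s0
  proof -
    have "2 * s0 \<noteq> 0" using that by simp
    then obtain u where u: "jfrac_orbit g A B PJ (QJ u) u dJ vJ" "u 1 = 2 * s0"
      using jfrac_orbit_exists[OF data AB] by blast
    have "same_fun \<Gamma> (\<lambda>p. F 0 p / xco p - w 0) (\<lambda>p. s0 * quad_fun (PJ 1) (QJ u 1) (?\<phi> p))"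
      using F_fun[of u 0] u(2) that by simp
    moreover have "s0 = u 1 / 2" using u(2) by simp
    ultimately show ?thesis using u(1) by blast
  qed
  have uniqueness: "d (j + 1) = w (2 * j - 1) * w (2 * j) \<and>
      v (j + 1) = - w (2 * j) - w (2 * j + 1) - c 1 / (2 * (of_nat g + 1)) \<and>
      same_fun \<Gamma> (\<lambda>p. F (2 * j) p / xco p - w (2 * j))
        (\<lambda>p. u (j + 1) / 2 * quad_fun (P' (j + 1)) (Q' (j + 1)) (?\<phi> p))"
    if orb: "jfrac_orbit g A B P' Q' u d v"
      and start: "same_fun \<Gamma> (\<lambda>p. F 0 p / xco p - w 0)
        (\<lambda>p. u 1 / 2 * quad_fun (P' 1) (Q' 1) (?\<phi> p))" for P' Q' u d v j
  proof -
    have u1: "u 1 \<noteq> 0" by (rule jfrac_orbitD(1)[OF orb g])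
    \<comment> \<open>Comparison orbit with the same prefactor \<open>u 1\<close>: both functions
      \<open>Y_1\<close> then have the same pullback to \<open>\<Gamma>\<close> and hence agree on
      the J-fraction curve.\<close>
    obtain u' where u': "jfrac_orbit g A B PJ (QJ u') u' dJ vJ" "u' 1 = u 1"
      using jfrac_orbit_exists[OF data AB u1] by blast
    have "same_fun \<Gamma> (\<lambda>p. F 0 p / xco p - w 0) (\<lambda>p. u 1 / 2 * quad_fun (PJ 1) (QJ u' 1) (?\<phi> p))"
      using F_fun[of u' 0] u'(2) u1 by simp
    from same_fun_trans[OF same_fun_sym[OF start] this]
    have "same_fun \<Gamma> (\<lambda>p. quad_fun (P' 1) (Q' 1) (?\<phi> p)) (\<lambda>p. quad_fun (PJ 1) (QJ u' 1) (?\<phi> p))"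
      using u1 by (simp add: same_fun_def)
    then have sf: "same_fun (completed_curve g ?F) (quad_fun (P' 1) (Q' 1)) (quad_fun (PJ 1) (QJ u' 1))"
      using iso same_fun_bij unfolding curve_iso_def by blast
    have nz: "Q' 1 \<noteq> 0" "QJ u' 1 \<noteq> 0"
      using u1 u'(2) jfrac_orbitD(3)[OF orb g, of 1] jfrac_orbitD(3)[OF u'(1) g, of 1] by auto
    \<comment> \<open>Equality at the single index 1 is enough, since the recurrence propagates it
      to all integers.\<close>
    note eq = quad_fun_unique[OF F_nz nz sf]
    note unique = jfrac_orbit_unique[OF orb u'(1) g eq]
    have "same_fun \<Gamma> (\<lambda>p. F (2 * j) p / xco p - w (2 * j))
        (\<lambda>p. u (j + 1) / 2 * quad_fun (P' (j + 1)) (Q' (j + 1)) (?\<phi> p))"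
      using F_fun[of u' j] jfrac_orbitD(1)[OF u'(1) g, of "j + 1"] by (simp add: unique)
    moreover have "v (j + 1) = - w (2 * j) - w (2 * j + 1) - c 1 / (2 * (of_nat g + 1))"
      unfolding unique(5) vJ_def shift a_def w_def by (simp add: algebra_simps)
    moreover have "d (j + 1) = w (2 * j - 1) * w (2 * j)"
      unfolding unique(4) dJ_def w_def by simp
    ultimately show ?thesis by blast
  qed
  show ?thesis
  proof (rule exI[of _ A], rule exI[of _ B], rule exI[of _ ?\<phi>], intro conjI)
    show "jfrac_curve_data g A B" by (rule data)
    show "curve_iso g \<Gamma> (completed_curve g (A\<^sup>2 + 4 * B)) ?\<phi>" unfolding AB by (rule iso)
    show "\<forall>x y. Affine x y \<in> \<Gamma> \<and> x \<noteq> 0 \<longrightarrow>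
       ?\<phi> (Affine x y) = Affine (1 / x + c 1 / (2 * of_nat g + 2)) (y / x ^ (g + 1))"
      by (simp add: shift a_def)
  qed (use existence in blast, use uniqueness in blast)
qed

end
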